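(* Let $\lambda\in\mathbb R$, $a\in L^\infty(\Omega)$, $K,Q\in L^\infty(\Omega\times\Omega)$ and $f\in X^{-s}(\Omega)$. Set $$\eta=C_{S,2}^2\bigl(\|a\|_\infty+|\Omega|\,\|K\|_\infty\bigr),\qquad \gamma=|\lambda|\,\|Q\|_\infty C_{S,q}^{2q}.$$ Assume that $\eta<1$ and that $r>0$ satisfies $\gamma r^{2q-2}+\|f\|_{X^{-s}}/r\le 1-\eta$. Assume moreover that $K,Q\ge 0$ a.e. in $\Omega\times\Omega$ and $f\ge 0$ in $X^{-s}(\Omega)$. (i) If $\lambda\ge 0$ and $a\ge 0$, there exists a nonnegative weak solution $u$ of problem (P) with $\|u\|_{X_0^s}\le r$. (ii) If $\lambda<0$, every weak solution of (P) is nonnegative, without any sign restriction on $a$. In either case, the solution is nontrivial whenever $f\ne 0$.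
   Context: Throughout, $\Omega\subset\mathbb R^N$, $N\ge 2$, is a bounded domain with Lipschitz boundary, $s\in(0,1)$, $2_s^*=\frac{2N}{N-2s}$ and $1<q<2_s^*$. $X_0^s(\Omega)=\{u\in H^s(\mathbb R^N): u=0 \text{ a.e. in }\mathbb R^N\setminus\Omega\}$, with the form $$\mathcal E_s(u,v)=\frac{C_{N,s}}2\iint_{\mathbb R^{2N}}\frac{(u(x)-u(y))(v(x)-v(y))}{|x-y|^{N+2s}}\,dx\,dy,\qquad C_{N,s}=\frac{4^s s\,\Gamma(N/2+s)}{\pi^{N/2}\Gamma(1-s)},$$ and norm $\|u\|_{X_0^s}=\mathcal E_s(u,u)^{1/2}$, which makes it a Hilbert space. $X^{-s}(\Omega)$ is its dual, with the dual norm and pairing $\langle\cdot,\cdot\rangle$. For $f\in X^{-s}(\Omega)$, $f\ge 0$ means $\langle f,\varphi\rangle\ge 0$ for every nonnegative $\varphi\in X_0^s(\Omega)$. For $1\le p\le 2_s^*$, $C_{S,p}>0$ denotes a fixed constant with $\|u\|_{L^p(\Omega)}\le C_{S,p}\|u\|_{X_0^s}$ for all $u\in X_0^s(\Omega)$. $\|K\|_\infty,\|Q\|_\infty$ are $L^\infty(\Omega\times\Omega)$ norms, $\|a\|_\infty$ is the $L^\infty(\Omega)$ norm, $|\Omega|$ is the Lebesgue measure. $(T_Ku)(x)=\int_\Omega K(x,y)u(y)\,dy$, $B_Q(u)(x)=\int_\Omega Q(x,y)|u(y)|^q\,dy$, $\mathcal N_Q(u)=|u|^{q-2}u\,B_Q(u)$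 (with $|u|^{q-2}u:=0$ where $u=0$), and $$\mathcal A_s(u,v)=\mathcal E_s(u,v)-\int_\Omega (T_Ku)v\,dx-\int_\Omega a\,uv\,dx.$$ Problem (P) is: $(-\Delta)^su-T_Ku=au+\lambda\mathcal N_Q(u)+f$ in $\Omega$, $u=0$ in $\mathbb R^N\setminus\Omega$. A weak solution of (P) is a function $u\in X_0^s(\Omega)$ with $\mathcal A_s(u,\varphi)=\lambda\int_\Omega\mathcal N_Q(u)\varphi\,dx+\langle f,\varphi\rangle$ for every $\varphi\in X_0^s(\Omega)$. *)

theory Defs
  imports "HOL-Probability.Essential_Supremum"
begin

(* Elements of L^p, L^\<infinity> and H^s are represented by Borel measurable functions (every class of
   Lebesgue measurable functions modulo a.e. equality has a Borel representative), and equality,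
   nonnegativity etc. are understood a.e. *)

abbreviation lborel_on :: "'a::euclidean_space set \<Rightarrow> 'a measure" where
  "lborel_on A \<equiv> restrict_space lborel A"

definition Linf :: "'a measure \<Rightarrow> ('a \<Rightarrow> real) set" where
  "Linf M = {g \<in> borel_measurable M. esssup M (\<lambda>x. ereal \<bar>g x\<bar>) < \<infinity>}"

definition Linf_norm :: "'a measure \<Rightarrow> ('a \<Rightarrow> real) \<Rightarrow> real" where
  "Linf_norm M g = real_of_ereal (esssup M (\<lambda>x. ereal \<bar>g x\<bar>))"

definition Lp :: "real \<Rightarrow> 'a measure \<Rightarrow> ('a \<Rightarrow> real) set" where
  "Lp p M = {g \<in> borel_measurable M. integrable M (\<lambda>x. \<bar>g x\<bar> powr p)}"

definition Lp_norm :: "real \<Rightarrow> 'a measure \<Rightarrow> ('a \<Rightarrow> real) \<Rightarrow> real" where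
  "Lp_norm p M g = (LINT x|M. \<bar>g x\<bar> powr p) powr (1 / p)"

(* Near each boundary point, \<Omega> lies strictly above the graph, in some direction e, of a Lipschitz
   function g on the hyperplane orthogonal to e. *)
definition lipschitz_boundary :: "'a::euclidean_space set \<Rightarrow> bool" where
  "lipschitz_boundary \<Omega> \<longleftrightarrow>
     (\<forall>x \<in> frontier \<Omega>. \<exists>e \<rho> L. \<exists>g :: 'a \<Rightarrow> real.
        norm e = 1 \<and> 0 < \<rho> \<and> L-lipschitz_on {z. z \<bullet> e = 0} g \<and>
        (\<forall>y \<in> ball x \<rho>. y \<in> \<Omega> \<longleftrightarrow> g (y - (y \<bullet> e) *\<^sub>R e) < y \<bullet> e) \<and>
        (\<forall>y \<in> ball x \<rho>. y \<in> frontier \<Omega> \<longleftrightarrow> g (y - (y \<bullet> e) *\<^sub>R e) = y \<bullet> e))"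

definition bounded_lipschitz_domain :: "'a::euclidean_space set \<Rightarrow> bool" where
  "bounded_lipschitz_domain \<Omega> \<longleftrightarrow>
     open \<Omega> \<and> connected \<Omega> \<and> \<Omega> \<noteq> {} \<and> bounded \<Omega> \<and> lipschitz_boundary \<Omega>"

(* The type argument only serves to supply the dimension N = CARD('n). *)
definition crit_exp :: "'n::finite itself \<Rightarrow> real \<Rightarrow> real" where
  "crit_exp _ s = 2 * real CARD('n) / (real CARD('n) - 2 * s)"

definition frac_const :: "'n::finite itself \<Rightarrow> real \<Rightarrow> real" where
  "frac_const _ s = 4 powr s * s * Gamma (real CARD('n) / 2 + s) /
                    (pi powr (real CARD('n) / 2) * Gamma (1 - s))"

(* On the null set x = y this is 0, by the convention z / 0 = 0. *)
definition gagliardo_kernel ::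
  "real \<Rightarrow> (real^'n \<Rightarrow> real) \<Rightarrow> (real^'n \<Rightarrow> real) \<Rightarrow> (real^'n) \<times> (real^'n) \<Rightarrow> real" where
  "gagliardo_kernel s u v =
     (\<lambda>(x, y). (u x - u y) * (v x - v y) / norm (x - y) powr (real CARD('n) + 2 * s))"

definition Hs :: "real \<Rightarrow> (real^'n \<Rightarrow> real) set" where
  "Hs s = {u \<in> Lp 2 lborel. integrable (lborel \<Otimes>\<^sub>M lborel) (gagliardo_kernel s u u)}"

definition X0 :: "real \<Rightarrow> (real^'n) set \<Rightarrow> (real^'n \<Rightarrow> real) set" where
  "X0 s \<Omega> = {u \<in> Hs s. AE x in lborel. x \<notin> \<Omega> \<longrightarrow> u x = 0}"

definition energy :: "real \<Rightarrow> (real^'n \<Rightarrow> real) \<Rightarrow> (real^'n \<Rightarrow> real) \<Rightarrow> real" where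
  "energy s u v = frac_const TYPE('n) s / 2 * (LINT z|(lborel \<Otimes>\<^sub>M lborel). gagliardo_kernel s u v z)"

definition X0_norm :: "real \<Rightarrow> (real^'n \<Rightarrow> real) \<Rightarrow> real" where
  "X0_norm s u = sqrt (energy s u u)"

(* Boundedness makes a functional respect a.e. equality. *)
definition X0_dual :: "real \<Rightarrow> (real^'n) set \<Rightarrow> ((real^'n \<Rightarrow> real) \<Rightarrow> real) set" where
  "X0_dual s \<Omega> = {f.
     (\<forall>u \<in> X0 s \<Omega>. \<forall>v \<in> X0 s \<Omega>. f (\<lambda>x. u x + v x) = f u + f v) \<and>
     (\<forall>c. \<forall>u \<in> X0 s \<Omega>. f (\<lambda>x. c * u x) = c * f u) \<and>
     (\<exists>C. \<forall>u \<in> X0 s \<Omega>. \<bar>f u\<bar> \<le> C * X0_norm s u)}"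

definition X0_dual_norm :: "real \<Rightarrow> (real^'n) set \<Rightarrow> ((real^'n \<Rightarrow> real) \<Rightarrow> real) \<Rightarrow> real" where
  "X0_dual_norm s \<Omega> f = (SUP u \<in> {u \<in> X0 s \<Omega>. X0_norm s u \<le> 1}. \<bar>f u\<bar>)"

definition X0_dual_nonneg :: "real \<Rightarrow> (real^'n) set \<Rightarrow> ((real^'n \<Rightarrow> real) \<Rightarrow> real) \<Rightarrow> bool" where
  "X0_dual_nonneg s \<Omega> f \<longleftrightarrow> (\<forall>\<phi> \<in> X0 s \<Omega>. (AE x in lborel. 0 \<le> \<phi> x) \<longrightarrow> 0 \<le> f \<phi>)"

(* A functional is only relevant on X0, so "f is not the zero functional" is stated there. *)
definition X0_dual_nonzero :: "real \<Rightarrow> (real^'n) set \<Rightarrow> ((real^'n \<Rightarrow> real) \<Rightarrow> real) \<Rightarrow> bool" where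
  "X0_dual_nonzero s \<Omega> f \<longleftrightarrow> (\<exists>\<phi> \<in> X0 s \<Omega>. f \<phi> \<noteq> 0)"

definition sobolev_const :: "real \<Rightarrow> (real^'n) set \<Rightarrow> real \<Rightarrow> real \<Rightarrow> bool" where
  "sobolev_const s \<Omega> p C \<longleftrightarrow>
     0 < C \<and> (\<forall>u \<in> X0 s \<Omega>. u \<in> Lp p (lborel_on \<Omega>) \<and> Lp_norm p (lborel_on \<Omega>) u \<le> C * X0_norm s u)"

definition T_op ::
  "(real^'n) set \<Rightarrow> ((real^'n) \<times> (real^'n) \<Rightarrow> real) \<Rightarrow> (real^'n \<Rightarrow> real) \<Rightarrow> real^'n \<Rightarrow> real" where
  "T_op \<Omega> K u x = (LINT y|lborel_on \<Omega>. K (x, y) * u y)"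

definition B_op ::
  "(real^'n) set \<Rightarrow> real \<Rightarrow> ((real^'n) \<times> (real^'n) \<Rightarrow> real) \<Rightarrow> (real^'n \<Rightarrow> real) \<Rightarrow> real^'n \<Rightarrow> real" where
  "B_op \<Omega> q Q u x = (LINT y|lborel_on \<Omega>. Q (x, y) * \<bar>u y\<bar> powr q)"

definition N_op ::
  "(real^'n) set \<Rightarrow> real \<Rightarrow> ((real^'n) \<times> (real^'n) \<Rightarrow> real) \<Rightarrow> (real^'n \<Rightarrow> real) \<Rightarrow> real^'n \<Rightarrow> real" where
  "N_op \<Omega> q Q u x = \<bar>u x\<bar> powr (q - 2) * u x * B_op \<Omega> q Q u x"

definition A_form ::
  "real \<Rightarrow> (real^'n) set \<Rightarrow> ((real^'n) \<times> (real^'n) \<Rightarrow> real) \<Rightarrow> (real^'n \<Rightarrow> real) \<Rightarrow>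
   (real^'n \<Rightarrow> real) \<Rightarrow> (real^'n \<Rightarrow> real) \<Rightarrow> real" where
  "A_form s \<Omega> K a u v =
     energy s u v - (LINT x|lborel_on \<Omega>. T_op \<Omega> K u x * v x) - (LINT x|lborel_on \<Omega>. a x * u x * v x)"

definition weak_solution ::
  "real \<Rightarrow> (real^'n) set \<Rightarrow> real \<Rightarrow> real \<Rightarrow> (real^'n \<Rightarrow> real) \<Rightarrow>
   ((real^'n) \<times> (real^'n) \<Rightarrow> real) \<Rightarrow> ((real^'n) \<times> (real^'n) \<Rightarrow> real) \<Rightarrow>
   ((real^'n \<Rightarrow> real) \<Rightarrow> real) \<Rightarrow> (real^'n \<Rightarrow> real) \<Rightarrow> bool" where
  "weak_solution s \<Omega> q lam a K Q f u \<longleftrightarrow>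
     u \<in> X0 s \<Omega> \<and>
     (\<forall>\<phi> \<in> X0 s \<Omega>.
        A_form s \<Omega> K a u \<phi> = lam * (LINT x|lborel_on \<Omega>. N_op \<Omega> q Q u x * \<phi> x) + f \<phi>)"

end

theory Submission
  imports Defs
begin

text \<open>
  For \<open>\<lambda> \<ge> 0\<close> the right-hand side \<open>R(w)(\<phi>) = \<integral>(T w)\<phi> + \<integral>a w \<phi> + \<lambda>\<integral>N(w)\<phi> + f(\<phi>)\<close> is monotone
  in \<open>w \<ge> 0\<close>. Hence the iterates \<open>u\<^sub>0 = 0\<close>, \<open>\<E>(u\<^sub>n\<^sub>+\<^sub>1, \<sqdot>) = R(u\<^sub>n)\<close> (Riesz) increase, because
  testing with the negative part shows that \<open>\<E>(u, \<sqdot>) \<ge> 0\<close> implies \<open>u \<ge> 0\<close>; the smallness assumption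
  keeps them in the ball of radius \<open>r\<close>. Monotonicity also gives
  \<open>\<E>(u\<^sub>n, u\<^sub>m) \<ge> \<E>(u\<^sub>m, u\<^sub>m)\<close> for \<open>n \<ge> m\<close>, so
  \<open>\<parallel>u\<^sub>n - u\<^sub>m\<parallel>\<^sup>2 \<le> \<parallel>u\<^sub>n\<parallel>\<^sup>2 - \<parallel>u\<^sub>m\<parallel>\<^sup>2\<close>: the bounded increasing sequence of energies
  makes the iteration converge strongly, with no compactness argument, and dominated convergence
  identifies the limit as a solution.

  For \<open>\<lambda> < 0\<close>, testing with the negative part \<open>w\<close> of \<open>u\<close> gives \<open>\<E>(w, w) \<le> \<eta> \<E>(w, w)\<close>, since the
  nonlinear term and \<open>f\<close> have the favourable sign, and \<open>\<eta> < 1\<close>.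
\<close>

section \<open>Riesz representation in a space of functions\<close>

text \<open>Evaluation at the minimiser \<open>- B / D\<close>; for \<open>D = 0\<close> an affine
  function that stays nonnegative has slope zero. It yields Cauchy-Schwarz and, in the Riesz
  theorem, the vanishing of the first variation.\<close>

lemma quadratic_nonneg_discriminant:
  fixes A B D :: real
  assumes "\<And>t. 0 \<le> A + 2 * t * B + t\<^sup>2 * D" and "0 \<le> D"
  shows "B\<^sup>2 \<le> A * D"
proof (cases "D = 0")
  case True
  show ?thesis
  proof (cases "B = 0")
    case False
    \<comment> \<open>At this argument the affine function takes the value -1.\<close>
    have "2 * (- (A + 1) / (2 * B)) * B = - (A + 1)"
      using False by (simp add: field_simps)
    then show ?thesis
      using assms(1)[of "- (A + 1) / (2 * B)"] True by simp
  qed (use True in simp)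
next
  case False
  then have D: "0 < D"
    using assms(2) by simp
  have "A + 2 * (- B / D) * B + (- B / D)\<^sup>2 * D = A - B\<^sup>2 / D"
    using D by (simp add: field_simps power2_eq_square)
  then have "B\<^sup>2 / D \<le> A"
    using assms(1)[of "- B / D"] by simp
  then show ?thesis
    using D by (simp add: divide_le_eq)
qed

locale semi_hilbert =
  fixes V :: "('a \<Rightarrow> real) set"
    and E :: "('a \<Rightarrow> real) \<Rightarrow> ('a \<Rightarrow> real) \<Rightarrow> real"
  assumes V_comb: "\<And>u v c. u \<in> V \<Longrightarrow> v \<in> V \<Longrightarrow> (\<lambda>x. u x + c * v x) \<in> V"
    and V_nonempty: "V \<noteq> {}"
    and E_comb: "\<And>u v w c. u \<in> V \<Longrightarrow> v \<in> V \<Longrightarrow> w \<in> V \<Longrightarrow>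
                   E (\<lambda>x. u x + c * v x) w = E u w + c * E v w"
    and E_sym: "\<And>u v. u \<in> V \<Longrightarrow> v \<in> V \<Longrightarrow> E u v = E v u"
    and E_nonneg: "\<And>u. u \<in> V \<Longrightarrow> 0 \<le> E u u"
    and E_complete: "\<And>U. (\<And>n::nat. U n \<in> V) \<Longrightarrow>
          (\<And>e. 0 < e \<Longrightarrow> \<exists>N. \<forall>m\<ge>N. \<forall>n\<ge>N.
             E (\<lambda>x. U m x - U n x) (\<lambda>x. U m x - U n x) < e) \<Longrightarrow>
          \<exists>u\<in>V. (\<lambda>n. E (\<lambda>x. U n x - u x) (\<lambda>x. U n x - u x)) \<longlonglongrightarrow> 0"
begin

definition bdd_functional :: "(('a \<Rightarrow> real) \<Rightarrow> real) \<Rightarrow> bool" where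
  "bdd_functional F \<longleftrightarrow>
     (\<forall>u\<in>V. \<forall>v\<in>V. \<forall>c. F (\<lambda>x. u x + c * v x) = F u + c * F v) \<and>
     (\<exists>C. \<forall>u\<in>V. \<bar>F u\<bar> \<le> C * sqrt (E u u))"

lemma V_diff: "u \<in> V \<Longrightarrow> v \<in> V \<Longrightarrow> (\<lambda>x. u x - v x) \<in> V"
  using V_comb[of u v "-1"] by simp

lemma E_diff:
  "u \<in> V \<Longrightarrow> v \<in> V \<Longrightarrow> w \<in> V \<Longrightarrow> E (\<lambda>x. u x - v x) w = E u w - E v w"
  using E_comb[of u v w "-1"] by simp

lemma E_comb_right:
  "u \<in> V \<Longrightarrow> v \<in> V \<Longrightarrow> w \<in> V \<Longrightarrow> E w (\<lambda>x. u x + c * v x) = E w u + c * E w v"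
  using E_comb[of u v w c] E_sym V_comb by metis

lemma E_diff_self:
  assumes "u \<in> V" "v \<in> V"
  shows "E (\<lambda>x. u x - v x) (\<lambda>x. u x - v x) = E u u - 2 * E u v + E v v"
proof -
  have "E (\<lambda>x. u x - v x) (\<lambda>x. u x - v x) =
        E u (\<lambda>x. u x - v x) - E v (\<lambda>x. u x - v x)"
    using assms E_diff V_diff by blast
  also have "\<dots> = (E u u - E v u) - (E u v - E v v)"
    using assms E_diff[of u v] E_sym V_diff by metis
  finally show ?thesis
    using E_sym[OF assms] by simp
qed

lemma E_comb_self:
  assumes "u \<in> V" "v \<in> V"
  shows "E (\<lambda>x. u x + t * v x) (\<lambda>x. u x + t * v x) = E u u + 2 * t * E u v + t\<^sup>2 * E v v"
  using assms V_comb[of u v t]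
  by (simp add: E_comb E_comb_right E_sym[of v u] power2_eq_square algebra_simps)

lemma Cauchy_Schwarz_sq:
  assumes "u \<in> V" "v \<in> V"
  shows "(E u v)\<^sup>2 \<le> E u u * E v v"
proof (rule quadratic_nonneg_discriminant)
  show "0 \<le> E u u + 2 * t * E u v + t\<^sup>2 * E v v" for t
    using E_nonneg[OF V_comb[OF assms, of t]] E_comb_self[OF assms, of t] by simp
qed (rule E_nonneg[OF assms(2)])

lemma tendsto_E_left:
  assumes "\<And>n. U n \<in> V" "u \<in> V" "w \<in> V"
    and lim: "(\<lambda>n. E (\<lambda>x. U n x - u x) (\<lambda>x. U n x - u x)) \<longlonglongrightarrow> 0"
  shows "(\<lambda>n. E (U n) w) \<longlonglongrightarrow> E u w"
proof -
  have "(\<lambda>n. (E (U n) w - E u w)\<^sup>2) \<longlonglongrightarrow> 0"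
  proof (rule tendsto_sandwich[where f = "\<lambda>_. 0"])
    show "(\<lambda>n. E (\<lambda>x. U n x - u x) (\<lambda>x. U n x - u x) * E w w) \<longlonglongrightarrow> 0"
      using tendsto_mult_right[OF lim, of "E w w"] by simp
    show "\<forall>\<^sub>F n in sequentially.
            (E (U n) w - E u w)\<^sup>2 \<le> E (\<lambda>x. U n x - u x) (\<lambda>x. U n x - u x) * E w w"
      using Cauchy_Schwarz_sq[OF V_diff[OF assms(1,2)] assms(3)] by (simp add: E_diff assms(1-3))
  qed auto
  then have "(\<lambda>n. E (U n) w - E u w) \<longlonglongrightarrow> 0"
    using tendsto_real_sqrt tendsto_rabs_zero_iff by fastforce
  then show ?thesis
    using LIM_zero_iff by blast
qed

lemma bdd_functional_comb:
  "bdd_functional F \<Longrightarrow> u \<in> V \<Longrightarrow> v \<in> V \<Longrightarrow> F (\<lambda>x. u x + c * v x) = F u + c * F v"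
  by (auto simp: bdd_functional_def)

text \<open>The direct method: the representative minimises \<open>E u u - 2 * F u\<close>. A
  minimising sequence is Cauchy by the parallelogram identity, and the Euler-Lagrange equation of
  its limit is the claim.\<close>

theorem riesz_representation:
  assumes F: "bdd_functional F"
  shows "\<exists>u\<in>V. \<forall>w\<in>V. E u w = F w"
proof -
  obtain C where C: "\<And>u. u \<in> V \<Longrightarrow> \<bar>F u\<bar> \<le> C * sqrt (E u u)"
    using F unfolding bdd_functional_def by blast
  define J where "J u = E u u - 2 * F u" for u
  define m where "m = Inf (J ` V)"
  have J_lower: "- C\<^sup>2 \<le> J u" if "u \<in> V" for u
  proof -
    \<comment> \<open>With t = \<open>sqrt (E u u)\<close>, the value \<open>J u\<close> is at least
      t^2 - 2 C t, hence at least - C^2.\<close>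
    have "0 \<le> (sqrt (E u u) - C)\<^sup>2"
      by simp
    also have "\<dots> = E u u - 2 * (C * sqrt (E u u)) + C\<^sup>2"
      using E_nonneg[OF that] by (simp add: power2_diff algebra_simps)
    finally show ?thesis
      using C[OF that] unfolding J_def by linarith
  qed
  have bdd: "bdd_below (J ` V)"
    using J_lower by (auto intro!: bdd_belowI2)
  have m_le: "m \<le> J u" if "u \<in> V" for u
    unfolding m_def using bdd that by (rule cINF_lower)
  have "\<exists>u\<in>V. J u < m + inverse (real (Suc n))" for n
    using cInf_lessD[of "J ` V" "m + inverse (real (Suc n))"] V_nonempty unfolding m_def by auto
  then obtain U where UV: "\<And>n. U n \<in> V" and U: "\<And>n. J (U n) < m + inverse (real (Suc n))"
    by metis
  have J_comb: "J (\<lambda>x. u x + t * v x) = J u + 2 * t * (E u v - F v) + t\<^sup>2 * E v v"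
    if "u \<in> V" "v \<in> V" for u v t
    using E_comb_self[OF that] bdd_functional_comb[OF F that] by (simp add: J_def algebra_simps)
  have cauchy: "E (\<lambda>x. U i x - U j x) (\<lambda>x. U i x - U j x)
                  \<le> 2 * inverse (real (Suc i)) + 2 * inverse (real (Suc j))" for i j
  proof -
    define d where "d = (\<lambda>x. U i x - U j x)"
    have d: "d \<in> V"
      unfolding d_def using UV V_diff by blast
    \<comment> \<open>\<open>U i\<close> and the midpoint are both of the form
      \<open>U j + t * d\<close>, for t = 1 and t = 1/2. Eliminating the linear term between the two
      expansions and bounding \<open>J\<close> at the midpoint below by \<open>m\<close> leaves
      \<open>E d d\<close> at most twice the sum of the excesses of \<open>J (U i)\<close> and
      \<open>J (U j)\<close> over \<open>m\<close>.\<close>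
    have "(\<lambda>x. U j x + 1 * d x) = U i"
      by (simp add: d_def fun_eq_iff)
    then have "J (U i) = J (U j) + 2 * (E (U j) d - F d) + E d d"
      using J_comb[OF UV[of j] d, of 1] by simp
    moreover have "J (\<lambda>x. U j x + 1/2 * d x) = J (U j) + (E (U j) d - F d) + E d d / 4"
      using J_comb[OF UV[of j] d, of "1/2"] by (simp add: power2_eq_square)
    moreover have "m \<le> J (\<lambda>x. U j x + 1/2 * d x)"
      using m_le V_comb[OF UV[of j] d] by blast
    ultimately show ?thesis
      using U[of i] U[of j] unfolding d_def[symmetric] by argo
  qed
  have "\<exists>N. \<forall>m\<ge>N. \<forall>n\<ge>N. E (\<lambda>x. U m x - U n x) (\<lambda>x. U m x - U n x) < e" if "0 < e" for e
  proof -
    obtain N where N: "inverse (real (Suc N)) < e / 4"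
      using reals_Archimedean[of "e / 4"] \<open>0 < e\<close> by auto
    have small: "inverse (real (Suc n)) < e / 4" if "N \<le> n" for n
    proof -
      have "inverse (real (Suc n)) \<le> inverse (real (Suc N))"
        using that by (intro le_imp_inverse_le) auto
      then show ?thesis
        using N by linarith
    qed
    then have "E (\<lambda>x. U m x - U n x) (\<lambda>x. U m x - U n x) < e" if "N \<le> m" "N \<le> n" for m n
      using cauchy[of m n] small[OF that(1)] small[OF that(2)] by linarith
    then show ?thesis
      by blast
  qed
  from E_complete[OF UV this] obtain u where u: "u \<in> V"
    and lim: "(\<lambda>n. E (\<lambda>x. U n x - u x) (\<lambda>x. U n x - u x)) \<longlonglongrightarrow> 0"
    by blast
  have "E u w = F w" if w: "w \<in> V" for w
  proof -
    \<comment> \<open>Since \<open>J (U n + t * w)\<close> is at least \<open>m\<close> for all t, a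
      quadratic in t with constant term \<open>inverse (real (Suc n))\<close> is nonnegative; its
      discriminant bounds the first variation at \<open>U n\<close>. The equation thus passes to the
      limit without evaluating \<open>J\<close> at \<open>u\<close>.\<close>
    have "(E (U n) w - F w)\<^sup>2 \<le> inverse (real (Suc n)) * E w w" for n
    proof (rule quadratic_nonneg_discriminant)
      fix t
      show "0 \<le> inverse (real (Suc n)) + 2 * t * (E (U n) w - F w) + t\<^sup>2 * E w w"
        using J_comb[OF UV[of n] w, of t] U[of n] m_le[OF V_comb[OF UV[of n] w, of t]] by linarith
    qed (rule E_nonneg[OF w])
    moreover have "(\<lambda>n. inverse (real (Suc n)) * E w w) \<longlonglongrightarrow> 0"
        using tendsto_mult_right[OF LIMSEQ_inverse_real_of_nat, of "E w w"] by simp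
    moreover have "(\<lambda>n. (E (U n) w - F w)\<^sup>2) \<longlonglongrightarrow> (E u w - F w)\<^sup>2"
      using tendsto_E_left[OF UV u w lim] by (intro tendsto_power tendsto_diff tendsto_const)
    ultimately have "(E u w - F w)\<^sup>2 \<le> 0"
      by (intro LIMSEQ_le[of _ _ "\<lambda>n. inverse (real (Suc n)) * E w w"]) auto
    then show ?thesis
      by simp
  qed
  then show ?thesis
    using u by blast
qed

end

section \<open>The fractional Sobolev space\<close>

lemma AE_lborel_pair:
  fixes P :: "'a::euclidean_space \<Rightarrow> bool"
  assumes "AE x in lborel. P x"
  shows "AE z in lborel \<Otimes>\<^sub>M lborel. P (fst z) \<and> P (snd z)"
proof -
  obtain N where N: "N \<in> null_sets lborel" and PN: "\<And>x. x \<notin> N \<Longrightarrow> P x"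
    using assms by (auto simp: eventually_ae_filter)
  have [measurable]: "N \<in> sets borel"
    using N by auto
  have "AE z in lborel \<Otimes>\<^sub>M lborel. fst z \<notin> N \<and> snd z \<notin> N"
  proof (rule lborel_pair.AE_pair_measure)
    show "AE x in lborel. AE y in lborel. fst (x, y) \<notin> N \<and> snd (x, y) \<notin> N"
      using AE_not_in[OF N] by eventually_elim (use AE_not_in[OF N] in simp)
  qed measurable
  then show ?thesis
    by eventually_elim (use PN in blast)
qed

text \<open>Fatou's lemma for nonnegative extended integrals, carried back to Bochner integrals;
  finiteness of the liminf makes the limit integrable. Lower semicontinuity of the energy rests on
  it.\<close>

lemma Fatou_integrable:
  fixes g :: "nat \<Rightarrow> 'a \<Rightarrow> real"
  assumes g: "\<And>k. integrable M (g k)" "\<And>k. AE x in M. 0 \<le> g k x"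
    and h[measurable]: "h \<in> borel_measurable M"
    and lim: "AE x in M. (\<lambda>k. g k x) \<longlonglongrightarrow> h x"
    and B: "\<And>k. integral\<^sup>L M (g k) \<le> B"
  shows "integrable M h" and "integral\<^sup>L M h \<le> B"
proof -
  have [measurable]: "g k \<in> borel_measurable M" for k
    using g(1) by auto
  have nonneg: "AE x in M. \<forall>k. 0 \<le> g k x"
    using g(2) by (simp add: AE_all_countable)
  have h0: "AE x in M. 0 \<le> h x"
    using nonneg lim by eventually_elim (auto intro: LIMSEQ_le_const)
  have "0 \<le> integral\<^sup>L M (g 0)"
    using g(2) by (rule integral_nonneg_AE)
  then have B0: "0 \<le> B"
    using B[of 0] by linarith
  have "(\<integral>\<^sup>+x. ennreal (h x) \<partial>M) = (\<integral>\<^sup>+x. liminf (\<lambda>k. ennreal (g k x)) \<partial>M)"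
    using lim
    by (intro nn_integral_cong_AE, eventually_elim)
       (metis lim_imp_Liminf tendsto_ennrealI trivial_limit_sequentially)
  also have "\<dots> \<le> liminf (\<lambda>k. \<integral>\<^sup>+x. ennreal (g k x) \<partial>M)"
    by (rule nn_integral_liminf) measurable
  also have "\<dots> \<le> liminf (\<lambda>k. ennreal B)"
    by (intro Liminf_mono always_eventually allI)
       (use g B in \<open>auto simp: nn_integral_eq_integral intro: ennreal_leI\<close>)
  finally have le: "(\<integral>\<^sup>+x. ennreal (h x) \<partial>M) \<le> ennreal B"
    by (simp add: Liminf_const)
  show int: "integrable M h"
    by (rule integrableI_nonneg[OF h h0]) (use le in \<open>auto intro: le_less_trans\<close>)
  show "integral\<^sup>L M h \<le> B"
    using le B0 int h0 by (simp add: nn_integral_eq_integral)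
qed

text \<open>Along indices whose successive L1 distances are below \<open>(1/2)^k\<close>, the sum of
  the absolute increments has finite integral. It is therefore finite almost everywhere, and the
  telescoping series converges there.\<close>

lemma L1_Cauchy_AE_subseq:
  fixes u :: "nat \<Rightarrow> 'a \<Rightarrow> real"
  assumes int: "\<And>n. integrable M (u n)"
    and cauchy: "\<And>e. 0 < e \<Longrightarrow> \<exists>N. \<forall>m\<ge>N. \<forall>n\<ge>N. (LINT x|M. \<bar>u m x - u n x\<bar>) < e"
  shows "\<exists>r. strict_mono r \<and> (AE x in M. convergent (\<lambda>k. u (r k) x))"
proof -
  have "\<exists>N. \<forall>m\<ge>N. \<forall>n\<ge>N. (LINT x|M. \<bar>u m x - u n x\<bar>) < (1/2)^k" for k :: nat
    by (rule cauchy) simp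
  then obtain N where N: "\<And>k m n. m \<ge> N k \<Longrightarrow> n \<ge> N k \<Longrightarrow>
      (LINT x|M. \<bar>u m x - u n x\<bar>) < (1/2)^k"
    by metis
  \<comment> \<open>Partial sums of \<open>Suc (N i)\<close> increase strictly and dominate every
    threshold \<open>N k\<close>, which avoids a recursive choice of indices.\<close>
  define r where "r k = (\<Sum>i\<le>k. Suc (N i))" for k
  have r: "strict_mono r"
    by (rule strict_monoI_Suc) (simp add: r_def)
  have rN: "N k \<le> r k" for k
    using member_le_sum[of k "{..k}" "\<lambda>i. Suc (N i)"] by (simp add: r_def)
  have rN': "N k \<le> r (Suc k)" for k
    using rN[of k] strict_monoD[OF r, of k "Suc k"] by simp
  define d where "d k x = u (r (Suc k)) x - u (r k) x" for k x
  have d_int: "integrable M (d k)" for k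
    unfolding d_def using int by simp
  have [measurable]: "d k \<in> borel_measurable M" for k
    using d_int by auto
  have "(\<integral>\<^sup>+x. (\<Sum>k. ennreal \<bar>d k x\<bar>) \<partial>M) = (\<Sum>k. \<integral>\<^sup>+x. ennreal \<bar>d k x\<bar> \<partial>M)"
    by (rule nn_integral_suminf) measurable
  also have "\<dots> \<le> (\<Sum>k. ennreal ((1/2)^k))"
  proof (intro suminf_le summableI)
    fix k
    have "(\<integral>\<^sup>+x. ennreal \<bar>d k x\<bar> \<partial>M) = ennreal (LINT x|M. \<bar>d k x\<bar>)"
      using d_int[of k] by (intro nn_integral_eq_integral) auto
    then show "(\<integral>\<^sup>+x. ennreal \<bar>d k x\<bar> \<partial>M) \<le> ennreal ((1/2)^k)"
      using N[OF rN'[of k] rN[of k]] by (simp add: d_def ennreal_leI)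
  qed
  also have "\<dots> = ennreal (\<Sum>k. (1/2)^k)"
    by (rule suminf_ennreal2) (auto intro: summable_geometric)
  also have "\<dots> < \<infinity>"
    by simp
  finally have "AE x in M. (\<Sum>k. ennreal \<bar>d k x\<bar>) \<noteq> \<infinity>"
    by (intro nn_integral_PInf_AE) auto
  then have "AE x in M. convergent (\<lambda>k. u (r k) x)"
  proof eventually_elim
    fix x assume "(\<Sum>k. ennreal \<bar>d k x\<bar>) \<noteq> \<infinity>"
    then have "summable (\<lambda>k. \<bar>d k x\<bar>)"
      by (intro summable_suminf_not_top) auto
    then have "convergent (\<lambda>n. \<Sum>k<n. d k x)"
      using summable_rabs_cancel summable_iff_convergent by blast
    then have "convergent (\<lambda>n. u (r n) x - u (r 0) x)"
      unfolding d_def by (simp add: sum_lessThan_telescope[of "\<lambda>k. u (r k) x"])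
    then show "convergent (\<lambda>k. u (r k) x)"
      using convergent_diff_const_right_iff by blast
  qed
  then show ?thesis
    using r by blast
qed

section \<open>The Gagliardo kernel, the energy form and negative parts\<close>

lemma abs_powr_2: "\<bar>x::real\<bar> powr 2 = x\<^sup>2"
  by (cases "x = 0") (auto simp: powr_numeral)

lemma Lp_2_iff:
  "u \<in> Lp 2 M \<longleftrightarrow> u \<in> borel_measurable M \<and> integrable M (\<lambda>x. (u x)\<^sup>2)"
  by (simp add: Lp_def abs_powr_2)

lemma gagliardo_kernel_measurable [measurable]:
  assumes [measurable]: "u \<in> borel_measurable lborel" "v \<in> borel_measurable lborel"
  shows "gagliardo_kernel s u v \<in> borel_measurable (lborel \<Otimes>\<^sub>M lborel)"
  unfolding gagliardo_kernel_def by measurable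

lemma gagliardo_kernel_comb:
  "gagliardo_kernel s (\<lambda>x. u x + c * v x) w z =
     gagliardo_kernel s u w z + c * gagliardo_kernel s v w z"
  by (cases z) (simp add: gagliardo_kernel_def add_divide_distrib[symmetric] algebra_simps)

lemma gagliardo_kernel_commute: "gagliardo_kernel s u v = gagliardo_kernel s v u"
  by (auto simp: gagliardo_kernel_def mult.commute)

lemma gagliardo_kernel_comb_right:
  "gagliardo_kernel s w (\<lambda>x. u x + c * v x) z =
     gagliardo_kernel s w u z + c * gagliardo_kernel s w v z"
  by (cases z) (simp add: gagliardo_kernel_def add_divide_distrib[symmetric] algebra_simps)

lemma gagliardo_kernel_nonneg: "0 \<le> gagliardo_kernel s u u z"
  by (cases z) (simp add: gagliardo_kernel_def)

lemma gagliardo_kernel_mono: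
  assumes "\<And>x y. (u x - u y) * (v x - v y) \<le> (u' x - u' y) * (v' x - v' y)"
  shows "gagliardo_kernel s u v z \<le> gagliardo_kernel s u' v' z"
  using assms by (cases z) (simp add: gagliardo_kernel_def divide_right_mono)

lemma abs_gagliardo_kernel_le:
  "\<bar>gagliardo_kernel s u v z\<bar> \<le> gagliardo_kernel s u u z + gagliardo_kernel s v v z"
proof -
  have "\<bar>a * b\<bar> \<le> a * a + b * b" for a b :: real
  proof -
    have "0 \<le> (\<bar>a\<bar> - \<bar>b\<bar>)\<^sup>2"
      by simp
    also have "\<dots> = a * a + b * b - 2 * \<bar>a * b\<bar>"
      by (simp add: power2_diff abs_mult) (simp add: power2_eq_square)
    finally show ?thesis
      by linarith
  qed
  then show ?thesis
    by (cases z)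
       (simp add: gagliardo_kernel_def add_divide_distrib[symmetric] abs_divide divide_right_mono)
qed

lemma Hs_measurable: "u \<in> Hs s \<Longrightarrow> u \<in> borel_measurable lborel"
  by (simp add: Hs_def Lp_def)

lemma gagliardo_kernel_integrable:
  fixes u v :: "real^'n \<Rightarrow> real"
  assumes "u \<in> Hs s" "v \<in> Hs s"
  shows "integrable (lborel \<Otimes>\<^sub>M lborel) (gagliardo_kernel s u v)"
proof (rule Bochner_Integration.integrable_bound)
  show "integrable (lborel \<Otimes>\<^sub>M lborel)
          (\<lambda>z. gagliardo_kernel s u u z + gagliardo_kernel s v v z)"
    using assms by (simp add: Hs_def)
  show "gagliardo_kernel s u v \<in> borel_measurable (lborel \<Otimes>\<^sub>M lborel)"
    using assms by (intro gagliardo_kernel_measurable Hs_measurable)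
  show "AE z in lborel \<Otimes>\<^sub>M lborel. norm (gagliardo_kernel s u v z) \<le>
          norm (gagliardo_kernel s u u z + gagliardo_kernel s v v z)"
    using abs_gagliardo_kernel_le[of s u v] by (intro AE_I2) (smt (verit) real_norm_def)
qed

lemma Hs_comb:
  fixes u v :: "real^'n \<Rightarrow> real"
  assumes u: "u \<in> Hs s" and v: "v \<in> Hs s"
  shows "(\<lambda>x. u x + c * v x) \<in> Hs s"
proof -
  have [measurable]: "u \<in> borel_measurable lborel" "v \<in> borel_measurable lborel"
    using u v Hs_measurable by auto
  have sq: "integrable lborel (\<lambda>x. (u x)\<^sup>2)" "integrable lborel (\<lambda>x. (v x)\<^sup>2)"
    using u v by (simp_all add: Hs_def Lp_2_iff)
  have "integrable lborel (\<lambda>x. (u x + c * v x)\<^sup>2)"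
  proof (rule Bochner_Integration.integrable_bound)
    show "integrable lborel (\<lambda>x. 2 * (u x)\<^sup>2 + 2 * c\<^sup>2 * (v x)\<^sup>2)"
      using sq by simp
    have "(u x + c * v x)\<^sup>2 \<le> 2 * (u x)\<^sup>2 + 2 * c\<^sup>2 * (v x)\<^sup>2" for x
      using zero_le_power2[of "u x - c * v x"] by (simp add: power2_eq_square algebra_simps)
    then show "AE x in lborel. norm ((u x + c * v x)\<^sup>2) \<le> norm (2 * (u x)\<^sup>2 + 2 * c\<^sup>2 * (v x)\<^sup>2)"
      by simp
  qed measurable
  moreover have "integrable (lborel \<Otimes>\<^sub>M lborel)
      (\<lambda>z. (gagliardo_kernel s u u z + c * gagliardo_kernel s u v z)
           + c * (gagliardo_kernel s v u z + c * gagliardo_kernel s v v z))"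
    by (intro Bochner_Integration.integrable_add integrable_mult_right gagliardo_kernel_integrable u v)
  then have "integrable (lborel \<Otimes>\<^sub>M lborel)
      (gagliardo_kernel s (\<lambda>x. u x + c * v x) (\<lambda>x. u x + c * v x))"
    by (subst Bochner_Integration.integrable_cong[OF refl])
       (auto simp: gagliardo_kernel_comb gagliardo_kernel_comb_right)
  ultimately show ?thesis
    by (simp add: Hs_def Lp_2_iff)
qed

lemma energy_comb:
  fixes u v w :: "real^'n \<Rightarrow> real"
  assumes "u \<in> Hs s" "v \<in> Hs s" "w \<in> Hs s"
  shows "energy s (\<lambda>x. u x + c * v x) w = energy s u w + c * energy s v w"
  using assms gagliardo_kernel_integrable[of u s w] gagliardo_kernel_integrable[of v s w]
  by (simp add: energy_def gagliardo_kernel_comb algebra_simps)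

lemma energy_commute: "energy s u v = energy s v u"
  unfolding energy_def by (subst gagliardo_kernel_commute) (rule refl)

lemma frac_const_pos:
  assumes "0 < s" "s < 1"
  shows "0 < frac_const TYPE('n::finite) s"
  using assms unfolding frac_const_def
  by (intro divide_pos_pos mult_pos_pos Gamma_real_pos add_nonneg_pos) auto

lemma energy_mono:
  fixes u v u' v' :: "real^'n \<Rightarrow> real"
  assumes "0 < s" "s < 1" "u \<in> Hs s" "v \<in> Hs s" "u' \<in> Hs s" "v' \<in> Hs s"
    and "\<And>x y. (u x - u y) * (v x - v y) \<le> (u' x - u' y) * (v' x - v' y)"
  shows "energy s u v \<le> energy s u' v'"
  unfolding energy_def using assms frac_const_pos[of s, where 'n='n]
  by (intro mult_left_mono integral_mono gagliardo_kernel_integrable gagliardo_kernel_mono) auto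

lemma energy_nonneg:
  fixes u :: "real^'n \<Rightarrow> real"
  assumes "0 < s" "s < 1"
  shows "0 \<le> energy s u u"
  unfolding energy_def using frac_const_pos[OF assms, where 'n='n]
  by (intro mult_nonneg_nonneg Bochner_Integration.integral_nonneg gagliardo_kernel_nonneg) auto

lemma energy_cong_AE:
  fixes u u' v :: "real^'n \<Rightarrow> real"
  assumes [measurable]: "u \<in> borel_measurable lborel" "u' \<in> borel_measurable lborel"
      "v \<in> borel_measurable lborel"
    and "AE x in lborel. u x = u' x"
  shows "energy s u v = energy s u' v"
proof -
  have "AE z in lborel \<Otimes>\<^sub>M lborel. gagliardo_kernel s u v z = gagliardo_kernel s u' v z"
    using AE_lborel_pair[OF assms(4)]
    by eventually_elim (auto simp: gagliardo_kernel_def split: prod.splits)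
  then show ?thesis
    unfolding energy_def by (intro arg_cong[where f = "(*) _"] integral_cong_AE) auto
qed

text \<open>The map from t to max(-t, 0) is 1-Lipschitz and vanishes at zero, so neither the squares
  nor the kernel increase.\<close>

lemma Hs_neg_part:
  fixes u :: "real^'n \<Rightarrow> real"
  assumes u: "u \<in> Hs s"
  shows "(\<lambda>x. max (- u x) 0) \<in> Hs s"
proof -
  have [measurable]: "u \<in> borel_measurable lborel"
    using u Hs_measurable by auto
  have "integrable lborel (\<lambda>x. (max (- u x) 0)\<^sup>2)"
  proof (rule Bochner_Integration.integrable_bound)
    show "integrable lborel (\<lambda>x. (u x)\<^sup>2)"
      using u by (simp add: Hs_def Lp_2_iff)
  qed (auto simp: max_def)
  moreover have "integrable (lborel \<Otimes>\<^sub>M lborel)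
      (gagliardo_kernel s (\<lambda>x. max (- u x) 0) (\<lambda>x. max (- u x) 0))"
  proof (rule Bochner_Integration.integrable_bound)
    show "integrable (lborel \<Otimes>\<^sub>M lborel) (gagliardo_kernel s u u)"
      using u by (simp add: Hs_def)
    have "gagliardo_kernel s (\<lambda>x. max (- u x) 0) (\<lambda>x. max (- u x) 0) z
            \<le> gagliardo_kernel s u u z" for z
    proof (rule gagliardo_kernel_mono)
      fix x y
      have "\<bar>max (- u x) 0 - max (- u y) 0\<bar> \<le> \<bar>u x - u y\<bar>"
        by (auto simp: max_def)
      then show "(max (- u x) 0 - max (- u y) 0) * (max (- u x) 0 - max (- u y) 0)
                   \<le> (u x - u y) * (u x - u y)"
        using abs_le_square_iff power2_eq_square by metis
    qed
    then show "AE z in lborel \<Otimes>\<^sub>M lborel.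
        norm (gagliardo_kernel s (\<lambda>x. max (- u x) 0) (\<lambda>x. max (- u x) 0) z)
          \<le> norm (gagliardo_kernel s u u z)"
      by (simp add: gagliardo_kernel_nonneg)
  qed measurable
  ultimately show ?thesis
    by (simp add: Hs_def Lp_2_iff)
qed

text \<open>Adding the negative part to \<open>u\<close> gives the positive part, and the increments
  of the two parts never have the same strict sign. Their mutual energy is therefore at most zero,
  which makes the negative part a useful test function.\<close>

lemma energy_neg_part_le:
  fixes u :: "real^'n \<Rightarrow> real"
  assumes s: "0 < s" "s < 1" and u: "u \<in> Hs s"
  shows "energy s u (\<lambda>x. max (- u x) 0)
           \<le> - energy s (\<lambda>x. max (- u x) 0) (\<lambda>x. max (- u x) 0)"
proof -
  define w where "w x = max (- u x) 0" for x
  have w: "w \<in> Hs s"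
    unfolding w_def by (rule Hs_neg_part[OF u])
  have zero: "(\<lambda>x. 0) \<in> Hs s"
    by (simp add: Hs_def Lp_def gagliardo_kernel_def case_prod_unfold)
  have "(u x + 1 * w x - (u y + 1 * w y)) * (w x - w y) \<le> 0" for x y
    unfolding w_def max_def by (auto intro: mult_nonneg_nonpos mult_nonpos_nonneg)
  then have "energy s (\<lambda>x. u x + 1 * w x) w \<le> energy s (\<lambda>x. 0) w"
    by (intro energy_mono s Hs_comb u w zero) simp
  also have "energy s (\<lambda>x. 0) w = 0"
    by (simp add: energy_def gagliardo_kernel_def case_prod_unfold)
  finally show ?thesis
    using energy_comb[OF u w w, of 1] unfolding w_def by simp
qed

section \<open>The space \<open>X0\<close>: embeddings, lower semicontinuity and
  completeness\<close>

lemma X0_Hs: "u \<in> X0 s \<Omega> \<Longrightarrow> u \<in> Hs s"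
  by (simp add: X0_def)

lemma X0_measurable: "u \<in> X0 s \<Omega> \<Longrightarrow> u \<in> borel_measurable lborel"
  using X0_Hs Hs_measurable by blast

lemma X0_comb:
  assumes "u \<in> X0 s \<Omega>" "v \<in> X0 s \<Omega>"
  shows "(\<lambda>x. u x + c * v x) \<in> X0 s \<Omega>"
proof -
  have "AE x in lborel. x \<notin> \<Omega> \<longrightarrow> u x = 0" "AE x in lborel. x \<notin> \<Omega> \<longrightarrow> v x = 0"
    using assms by (simp_all add: X0_def)
  then have "AE x in lborel. x \<notin> \<Omega> \<longrightarrow> u x + c * v x = 0"
    by eventually_elim simp
  then show ?thesis
    using assms by (simp add: X0_def Hs_comb)
qed

lemma X0_zero: "(\<lambda>x. 0) \<in> X0 s \<Omega>"
  by (simp add: X0_def Hs_def Lp_def gagliardo_kernel_def case_prod_unfold)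

lemma X0_diff: "u \<in> X0 s \<Omega> \<Longrightarrow> v \<in> X0 s \<Omega> \<Longrightarrow> (\<lambda>x. u x - v x) \<in> X0 s \<Omega>"
  using X0_comb[of u s \<Omega> v "-1"] by simp

lemma X0_neg_part:
  assumes "u \<in> X0 s \<Omega>"
  shows "(\<lambda>x. max (- u x) 0) \<in> X0 s \<Omega>"
  using assms by (auto simp: X0_def Hs_neg_part elim: eventually_mono)

text \<open>The two embedding constants do different work: the L1 bound produces almost everywhere
  convergent subsequences, while the L2 bound controls the Lebesgue part of \<open>Hs\<close>, gives
  definiteness and supplies the constant in \<eta>.\<close>

locale fractional_space =
  fixes s :: real and \<Omega> :: "(real^'n) set" and C1 C2 :: real
  assumes s: "0 < s" "s < 1"
    and dom: "open \<Omega>" "bounded \<Omega>"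
    and sob1: "sobolev_const s \<Omega> 1 C1"
    and sob2: "sobolev_const s \<Omega> 2 C2"
begin

abbreviation "M \<equiv> lborel_on \<Omega>"
abbreviation "X \<equiv> X0 s \<Omega>"
abbreviation "\<E> \<equiv> energy s"

lemma dom_borel [measurable]: "\<Omega> \<in> sets borel"
  using dom by simp

lemma AE_M_iff: "(AE x in M. P x) \<longleftrightarrow> (AE x in lborel. x \<in> \<Omega> \<longrightarrow> P x)"
  by (rule AE_restrict_space_iff) simp

lemma AE_M: "AE x in lborel. P x \<Longrightarrow> AE x in M. P x"
  unfolding AE_M_iff by (auto elim: eventually_mono)

lemma measurable_M: "u \<in> borel_measurable lborel \<Longrightarrow> u \<in> borel_measurable M"
  by (rule measurable_restrict_space1)

lemma X_measurable_M: "u \<in> X \<Longrightarrow> u \<in> borel_measurable M"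
  using X0_measurable measurable_M by blast

lemma X0_norm_sq: "(X0_norm s (u :: real^'n \<Rightarrow> real))\<^sup>2 = \<E> u u"
  using s energy_nonneg[of s u] by (simp add: X0_norm_def)

lemma X0_norm_nonneg: "0 \<le> X0_norm s (u :: real^'n \<Rightarrow> real)"
  using s energy_nonneg[of s u] by (simp add: X0_norm_def)

lemma X0_L1:
  assumes "u \<in> X"
  shows "integrable M u" and "(LINT x|M. \<bar>u x\<bar>) \<le> C1 * X0_norm s u"
proof -
  have "u \<in> Lp 1 M" "Lp_norm 1 M u \<le> C1 * X0_norm s u"
    using sob1 assms by (auto simp: sobolev_const_def)
  then show "integrable M u" "(LINT x|M. \<bar>u x\<bar>) \<le> C1 * X0_norm s u"
    using integrable_abs_cancel by (auto simp: Lp_def Lp_norm_def)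
qed

lemma X0_L2:
  assumes "u \<in> X"
  shows "integrable M (\<lambda>x. (u x)\<^sup>2)" and "(LINT x|M. (u x)\<^sup>2) \<le> C2\<^sup>2 * \<E> u u"
proof -
  have "u \<in> Lp 2 M" and le: "Lp_norm 2 M u \<le> C2 * X0_norm s u"
    using sob2 assms by (auto simp: sobolev_const_def)
  then show "integrable M (\<lambda>x. (u x)\<^sup>2)"
    by (simp add: Lp_2_iff)
  have "(Lp_norm 2 M u)\<^sup>2 \<le> (C2 * X0_norm s u)\<^sup>2"
    using le by (intro power_mono) (simp_all add: Lp_norm_def)
  moreover have "(Lp_norm 2 M u)\<^sup>2 = (LINT x|M. (u x)\<^sup>2)"
    by (simp add: Lp_norm_def abs_powr_2 powr_half_sqrt)
  ultimately show "(LINT x|M. (u x)\<^sup>2) \<le> C2\<^sup>2 * \<E> u u"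
    by (simp add: power_mult_distrib X0_norm_sq)
qed

text \<open>Off the domain \<open>u\<close> vanishes almost everywhere, so the embedding on the
  domain already bounds the integral over the whole space.\<close>

lemma X0_L2_lborel:
  assumes u: "u \<in> X"
  shows "(LINT x|lborel. (u x)\<^sup>2) \<le> C2\<^sup>2 * \<E> u u"
proof -
  have [measurable]: "u \<in> borel_measurable lborel"
    using u X0_measurable by blast
  have "AE x in lborel. x \<notin> \<Omega> \<longrightarrow> u x = 0"
    using u by (simp add: X0_def)
  then have "(LINT x|lborel. (u x)\<^sup>2) = (LINT x|lborel. indicat_real \<Omega> x *\<^sub>R (u x)\<^sup>2)"
    by (intro integral_cong_AE) (auto simp: indicator_def elim: eventually_mono)
  also have "\<dots> = (LINT x|M. (u x)\<^sup>2)"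
    by (rule integral_restrict_space[symmetric]) simp
  finally show ?thesis
    using X0_L2[OF u] by simp
qed

text \<open>Definiteness up to null sets is a consequence of the embedding into L2.\<close>

lemma energy_zero_imp_AE_zero:
  assumes u: "u \<in> X" and zero: "\<E> u u \<le> 0"
  shows "AE x in lborel. u x = 0"
proof -
  have int: "integrable lborel (\<lambda>x. (u x)\<^sup>2)"
    using u by (simp add: X0_def Hs_def Lp_2_iff)
  have "C2\<^sup>2 * \<E> u u \<le> 0"
    using zero by (simp add: mult_nonneg_nonpos)
  then have "(LINT x|lborel. (u x)\<^sup>2) = 0"
    using X0_L2_lborel[OF u] by (intro antisym integral_nonneg) auto
  then have "AE x in lborel. (u x)\<^sup>2 = 0"
    using int by (subst (asm) integral_nonneg_eq_0_iff_AE) auto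
  then show ?thesis
    by simp
qed

text \<open>Fatou is applied twice: to the squares, which puts \<open>v\<close> in L2, and to the
  kernels on the product space, which bounds the energy of \<open>v\<close>. Pointwise convergence
  of the kernels holds off a null set by \<open>AE_lborel_pair\<close>.\<close>

lemma X0_lower_semicontinuous:
  assumes w: "\<And>k. w k \<in> X" and v[measurable]: "v \<in> borel_measurable lborel"
    and lim: "AE x in lborel. (\<lambda>k. w k x) \<longlonglongrightarrow> v x"
    and B: "\<And>k::nat. \<E> (w k) (w k) \<le> B"
  shows "v \<in> X" and "\<E> v v \<le> B"
proof -
  have wint: "integrable lborel (\<lambda>x. (w k x)\<^sup>2)" for k
    using w[of k] by (simp add: X0_def Hs_def Lp_2_iff)
  have "integrable lborel (\<lambda>x. (v x)\<^sup>2)"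
  proof (rule Fatou_integrable(1)[OF wint])
    show "AE x in lborel. (\<lambda>k. (w k x)\<^sup>2) \<longlonglongrightarrow> (v x)\<^sup>2"
      using lim by eventually_elim (intro tendsto_intros)
    show "(LINT x|lborel. (w k x)\<^sup>2) \<le> C2\<^sup>2 * B" for k
      using X0_L2_lborel[OF w[of k]] mult_left_mono[OF B[of k], of "C2\<^sup>2"] by simp
  qed auto
  moreover
  have lim2: "AE z in lborel \<Otimes>\<^sub>M lborel.
      (\<lambda>k. gagliardo_kernel s (w k) (w k) z) \<longlonglongrightarrow> gagliardo_kernel s v v z"
    using AE_lborel_pair[OF lim]
  proof eventually_elim
    fix z :: "(real^'n) \<times> (real^'n)"
    assume "(\<lambda>k. w k (fst z)) \<longlonglongrightarrow> v (fst z) \<and> (\<lambda>k. w k (snd z)) \<longlonglongrightarrow> v (snd z)"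
    then show "(\<lambda>k. gagliardo_kernel s (w k) (w k) z) \<longlonglongrightarrow> gagliardo_kernel s v v z"
      unfolding gagliardo_kernel_def case_prod_unfold divide_inverse
      by (intro tendsto_mult_right tendsto_mult tendsto_diff) auto
  qed
  have c: "0 < frac_const TYPE('n) s / 2"
    using frac_const_pos[OF s] by simp
  have bound: "(LINT z|(lborel \<Otimes>\<^sub>M lborel). gagliardo_kernel s (w k) (w k) z)
                 \<le> B / (frac_const TYPE('n) s / 2)" for k
    using B[of k] c unfolding energy_def by (simp add: field_simps)
  have fatou: "integrable (lborel \<Otimes>\<^sub>M lborel) (gagliardo_kernel s v v)"
    "(LINT z|(lborel \<Otimes>\<^sub>M lborel). gagliardo_kernel s v v z) \<le> B / (frac_const TYPE('n) s / 2)"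
    by (rule Fatou_integrable[OF _ _ _ lim2 bound];
        simp add: gagliardo_kernel_integrable X0_Hs[OF w] gagliardo_kernel_nonneg gagliardo_kernel_measurable)+
  moreover have "AE x in lborel. \<forall>k. x \<notin> \<Omega> \<longrightarrow> w k x = 0"
    using w unfolding X0_def AE_all_countable by blast
  then have "AE x in lborel. x \<notin> \<Omega> \<longrightarrow> v x = 0"
    using lim by eventually_elim (auto simp: LIMSEQ_const_iff)
  ultimately show "v \<in> X"
    by (simp add: X0_def Hs_def Lp_2_iff)
  show "\<E> v v \<le> B"
    using fatou(2) c unfolding energy_def by (simp add: field_simps)
qed

text \<open>Cauchy in energy implies Cauchy in L1, and an almost everywhere convergent subsequence
  supplies the candidate \<open>u\<close>. Lower semicontinuity applied to \<open>U m - U n\<close>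
  with n fixed then gives energy convergence of the full sequence. The subsequence stays in the
  conclusion because the nonlinear term is later passed to the limit pointwise.\<close>

lemma X0_complete:
  assumes U: "\<And>n::nat. U n \<in> X"
    and cauchy: "\<And>e. 0 < e \<Longrightarrow>
          \<exists>N. \<forall>m\<ge>N. \<forall>n\<ge>N. \<E> (\<lambda>x. U m x - U n x) (\<lambda>x. U m x - U n x) < e"
  shows "\<exists>u\<in>X. \<exists>r. strict_mono r \<and> (AE x in lborel. (\<lambda>k. U (r k) x) \<longlonglongrightarrow> u x) \<and>
           (\<lambda>n. \<E> (\<lambda>x. U n x - u x) (\<lambda>x. U n x - u x)) \<longlonglongrightarrow> 0"
proof -
  have [measurable]: "U n \<in> borel_measurable lborel" for n
    using U X0_measurable by blast
  have C1: "0 < C1"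
    using sob1 by (simp add: sobolev_const_def)
  have "\<exists>N. \<forall>m\<ge>N. \<forall>n\<ge>N. (LINT x|M. \<bar>U m x - U n x\<bar>) < e" if "0 < e" for e
  proof -
    have "0 < (e / C1)\<^sup>2"
      using C1 that by simp
    then obtain N where N: "\<And>m n. m \<ge> N \<Longrightarrow> n \<ge> N \<Longrightarrow>
        \<E> (\<lambda>x. U m x - U n x) (\<lambda>x. U m x - U n x) < (e / C1)\<^sup>2"
      using cauchy by meson
    have "(LINT x|M. \<bar>U m x - U n x\<bar>) < e" if "m \<ge> N" "n \<ge> N" for m n
    proof -
      have "X0_norm s (\<lambda>x. U m x - U n x) < e / C1"
        unfolding X0_norm_def using N[OF that] \<open>0 < e\<close> C1
        by (intro real_less_lsqrt) auto
      then have "C1 * X0_norm s (\<lambda>x. U m x - U n x) < e"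
        using C1 by (simp add: field_simps)
      then show ?thesis
        using X0_L1(2)[OF X0_diff[OF U U], of m n] by linarith
    qed
    then show ?thesis
      by blast
  qed
  from L1_Cauchy_AE_subseq[OF X0_L1(1)[OF U] this]
  obtain r where r: "strict_mono r" and conv: "AE x in M. convergent (\<lambda>k. U (r k) x)"
    by auto
  \<comment> \<open>\<open>lim\<close> preserves measurability even at points where the sequence
    diverges. The indicator makes \<open>u\<close> zero off the domain, where almost everywhere all
    \<open>U k\<close> vanish.\<close>
  define u where "u x = indicator \<Omega> x * lim (\<lambda>k. U (r k) x)" for x
  have [measurable]: "u \<in> borel_measurable lborel"
    unfolding u_def by measurable
  have "AE x in lborel. \<forall>k. x \<notin> \<Omega> \<longrightarrow> U k x = 0"
    using U unfolding X0_def AE_all_countable by blast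
  moreover have "AE x in lborel. x \<in> \<Omega> \<longrightarrow> convergent (\<lambda>k. U (r k) x)"
    using conv unfolding AE_M_iff .
  ultimately have lim: "AE x in lborel. (\<lambda>k. U (r k) x) \<longlonglongrightarrow> u x"
    by eventually_elim (auto simp: u_def convergent_LIMSEQ_iff indicator_def)
  have key: "(\<lambda>x. u x - U n x) \<in> X \<and> \<E> (\<lambda>x. u x - U n x) (\<lambda>x. u x - U n x) \<le> e"
    if N: "\<And>m. m \<ge> N \<Longrightarrow> \<E> (\<lambda>x. U m x - U n x) (\<lambda>x. U m x - U n x) < e" for N n e
  proof -
    \<comment> \<open>The shift by \<open>N\<close> keeps every index \<open>r (k + N)\<close> at or
      above the threshold, so the energy bound holds for all k.\<close>
    define w where "w k = (\<lambda>x. U (r (k + N)) x - U n x)" for k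
    have "w k \<in> X" for k
      unfolding w_def by (intro X0_diff U)
    moreover have "(\<lambda>x. u x - U n x) \<in> borel_measurable lborel"
      by measurable
    moreover have "AE x in lborel. (\<lambda>k. w k x) \<longlonglongrightarrow> u x - U n x"
      using lim unfolding w_def
      by eventually_elim (intro tendsto_intros LIMSEQ_ignore_initial_segment)
    moreover have "\<E> (w k) (w k) \<le> e" for k
      unfolding w_def using N[of "r (k + N)"] seq_suble[OF r, of "k + N"] by simp
    ultimately show ?thesis
      using X0_lower_semicontinuous by blast
  qed
  obtain N where N: "\<And>m n. m \<ge> N \<Longrightarrow> n \<ge> N \<Longrightarrow>
        \<E> (\<lambda>x. U m x - U n x) (\<lambda>x. U m x - U n x) < 1"
    using cauchy[of 1] by auto
  \<comment> \<open>\<open>key\<close> speaks of differences only; membership of \<open>u\<close>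
    follows by adding one term of the sequence back.\<close>
  have "(\<lambda>x. u x - U N x) \<in> X"
    using key[of N N 1] N by simp
  then have u: "u \<in> X"
    using X0_comb[OF _ U[of N], of "\<lambda>x. u x - U N x" 1] by simp
  have sym: "\<E> (\<lambda>x. U n x - u x) (\<lambda>x. U n x - u x) = \<E> (\<lambda>x. u x - U n x) (\<lambda>x. u x - U n x)" for n
    by (simp add: energy_def gagliardo_kernel_def algebra_simps)
  have "(\<lambda>n. \<E> (\<lambda>x. U n x - u x) (\<lambda>x. U n x - u x)) \<longlonglongrightarrow> 0"
  proof (rule LIMSEQ_I)
    fix e :: real assume "0 < e"
    then obtain N where N: "\<And>m n. m \<ge> N \<Longrightarrow> n \<ge> N \<Longrightarrow>
        \<E> (\<lambda>x. U m x - U n x) (\<lambda>x. U m x - U n x) < e / 2"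
      using cauchy[of "e / 2"] by auto
    have "norm (\<E> (\<lambda>x. U n x - u x) (\<lambda>x. U n x - u x) - 0) < e" if "n \<ge> N" for n
      using key[of N n "e / 2"] N that \<open>0 < e\<close> energy_nonneg[OF s, of "\<lambda>x. u x - U n x"]
      by (simp add: sym)
    then show "\<exists>N. \<forall>n\<ge>N. norm (\<E> (\<lambda>x. U n x - u x) (\<lambda>x. U n x - u x) - 0) < e"
      by blast
  qed
  then show ?thesis
    using u r lim by blast
qed

sublocale semi_hilbert X \<E>
proof
  show "\<E> (\<lambda>x. u x + c * v x) w = \<E> u w + c * \<E> v w" if "u \<in> X" "v \<in> X" "w \<in> X" for u v w c
    using that by (simp add: energy_comb X0_Hs)
  show "X \<noteq> {}"
    using X0_zero by blast
  show "0 \<le> \<E> u u" if "u \<in> X" for u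
    by (rule energy_nonneg[OF s])
  show "\<exists>u\<in>X. (\<lambda>n. \<E> (\<lambda>x. U n x - u x) (\<lambda>x. U n x - u x)) \<longlonglongrightarrow> 0"
    if "\<And>n. U n \<in> X" "\<And>e. 0 < e \<Longrightarrow> \<exists>N. \<forall>m\<ge>N. \<forall>n\<ge>N.
             \<E> (\<lambda>x. U m x - U n x) (\<lambda>x. U m x - U n x) < e" for U :: "nat \<Rightarrow> real^'n \<Rightarrow> real"
    using X0_complete[OF that] by blast
  show "\<E> u v = \<E> v u" for u v
    by (rule energy_commute)
qed (rule X0_comb)

end

section \<open>The nonlocal problem with everywhere bounded coefficients\<close>

lemma weighted_AM_GM:
  fixes a b :: real
  assumes "0 \<le> \<alpha>" "0 \<le> \<beta>" "\<alpha> + \<beta> = 1" "0 \<le> a" "0 \<le> b"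
  shows "a powr \<alpha> * b powr \<beta> \<le> \<alpha> * a + \<beta> * b"
  using assms Youngs_inequality_0[of \<alpha> \<beta> a b] by (cases "a = 0 \<or> b = 0") auto

text \<open>Young's inequality for the normalised powers, integrated. The exponent
  \<open>q - 1\<close> takes the place of a conjugate exponent, since this is the form in which the
  nonlinearity appears.\<close>

lemma Holder_abs_powr:
  fixes f g :: "'a \<Rightarrow> real"
  assumes q: "1 < q"
    and [measurable]: "f \<in> borel_measurable M" "g \<in> borel_measurable M"
    and f: "integrable M (\<lambda>x. \<bar>f x\<bar> powr q)" and g: "integrable M (\<lambda>x. \<bar>g x\<bar> powr q)"
  shows "integrable M (\<lambda>x. \<bar>f x\<bar> powr (q - 1) * \<bar>g x\<bar>)"
    and "(LINT x|M. \<bar>f x\<bar> powr (q - 1) * \<bar>g x\<bar>) \<le>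
           (LINT x|M. \<bar>f x\<bar> powr q) powr ((q - 1) / q) * (LINT x|M. \<bar>g x\<bar> powr q) powr (1 / q)"
proof -
  define F where "F = (LINT x|M. \<bar>f x\<bar> powr q)"
  define G where "G = (LINT x|M. \<bar>g x\<bar> powr q)"
  \<comment> \<open>The weights c = d = 1 give integrability, the weights \<open>F\<close> and
    \<open>G\<close> give the sharp constant. If \<open>F\<close> or \<open>G\<close> is zero, the
    product vanishes almost everywhere instead.\<close>
  have young: "\<bar>f x\<bar> powr (q - 1) * \<bar>g x\<bar> \<le>
        (c powr ((q - 1) / q) * d powr (1 / q)) * ((q - 1) / q * (\<bar>f x\<bar> powr q / c) + 1 / q * (\<bar>g x\<bar> powr q / d))"
    if "0 < c" "0 < d" for c d x
  proof -
    have "(\<bar>f x\<bar> powr q / c) powr ((q - 1) / q) * (\<bar>g x\<bar> powr q / d) powr (1 / q) \<le>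
            (q - 1) / q * (\<bar>f x\<bar> powr q / c) + 1 / q * (\<bar>g x\<bar> powr q / d)"
      using q that by (intro weighted_AM_GM) (auto simp: field_simps)
    moreover have "(\<bar>f x\<bar> powr q / c) powr ((q - 1) / q) = \<bar>f x\<bar> powr (q - 1) / c powr ((q - 1) / q)"
      using q that by (simp add: powr_divide powr_powr)
    moreover have "(\<bar>g x\<bar> powr q / d) powr (1 / q) = \<bar>g x\<bar> / d powr (1 / q)"
      using q that by (simp add: powr_divide powr_powr)
    ultimately show ?thesis
      using that by (simp add: field_simps)
  qed
  show int: "integrable M (\<lambda>x. \<bar>f x\<bar> powr (q - 1) * \<bar>g x\<bar>)"
  proof (rule Bochner_Integration.integrable_bound)
    show "integrable M (\<lambda>x. (q - 1) / q * \<bar>f x\<bar> powr q + 1 / q * \<bar>g x\<bar> powr q)"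
      using f g by simp
    show "AE x in M. norm (\<bar>f x\<bar> powr (q - 1) * \<bar>g x\<bar>)
            \<le> norm ((q - 1) / q * \<bar>f x\<bar> powr q + 1 / q * \<bar>g x\<bar> powr q)"
      using young[of 1 1] q by (intro AE_I2) (simp add: order_trans[OF _ abs_ge_self])
  qed measurable
  have F0: "0 \<le> F" and G0: "0 \<le> G"
    unfolding F_def G_def by (auto intro!: Bochner_Integration.integral_nonneg)
  have "(LINT x|M. \<bar>f x\<bar> powr (q - 1) * \<bar>g x\<bar>) \<le> F powr ((q - 1) / q) * G powr (1 / q)"
  proof (cases "F = 0 \<or> G = 0")
    case True
    then have "AE x in M. \<bar>f x\<bar> powr (q - 1) * \<bar>g x\<bar> = 0"
    proof
      assume "F = 0"
      then have "AE x in M. \<bar>f x\<bar> powr q = 0"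
        unfolding F_def using f by (subst (asm) integral_nonneg_eq_0_iff_AE) auto
      then show ?thesis
        by eventually_elim simp
    next
      assume "G = 0"
      then have "AE x in M. \<bar>g x\<bar> powr q = 0"
        unfolding G_def using g by (subst (asm) integral_nonneg_eq_0_iff_AE) auto
      then show ?thesis
        by eventually_elim simp
    qed
    then have "(LINT x|M. \<bar>f x\<bar> powr (q - 1) * \<bar>g x\<bar>) = 0"
      by (rule integral_eq_zero_AE)
    then show ?thesis
      by simp
  next
    case False
    then have FG: "0 < F" "0 < G"
      using F0 G0 by auto
    have "(LINT x|M. \<bar>f x\<bar> powr (q - 1) * \<bar>g x\<bar>) \<le>
        (LINT x|M. (F powr ((q - 1) / q) * G powr (1 / q)) *
           ((q - 1) / q * (\<bar>f x\<bar> powr q / F) + 1 / q * (\<bar>g x\<bar> powr q / G)))"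
      using int f g young[OF FG] by (intro integral_mono) simp_all
    also have "\<dots> = (F powr ((q - 1) / q) * G powr (1 / q)) * ((q - 1) / q * (F / F) + 1 / q * (G / G))"
      using f g by (simp add: F_def G_def)
    also have "\<dots> = F powr ((q - 1) / q) * G powr (1 / q)"
      using FG q by (simp add: diff_divide_distrib)
    finally show ?thesis .
  qed
  then show "(LINT x|M. \<bar>f x\<bar> powr (q - 1) * \<bar>g x\<bar>) \<le>
           (LINT x|M. \<bar>f x\<bar> powr q) powr ((q - 1) / q) * (LINT x|M. \<bar>g x\<bar> powr q) powr (1 / q)"
    unfolding F_def G_def .
qed

lemma Cauchy_Schwarz_integral:
  fixes f g :: "'a \<Rightarrow> real"
  assumes "f \<in> borel_measurable M" "g \<in> borel_measurable M"
    and "integrable M (\<lambda>x. (f x)\<^sup>2)" "integrable M (\<lambda>x. (g x)\<^sup>2)"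
  shows "integrable M (\<lambda>x. \<bar>f x\<bar> * \<bar>g x\<bar>)"
    and "(LINT x|M. \<bar>f x\<bar> * \<bar>g x\<bar>) \<le> sqrt (LINT x|M. (f x)\<^sup>2) * sqrt (LINT x|M. (g x)\<^sup>2)"
  using Holder_abs_powr[of 2 f M g] assms by (simp_all add: abs_powr_2 powr_half_sqrt)

lemma abs_powr_measurable:
  fixes u :: "'a \<Rightarrow> real"
  assumes [measurable]: "u \<in> borel_measurable M"
  shows "(\<lambda>x. \<bar>u x\<bar> powr p) \<in> borel_measurable M"
  by measurable

text \<open>Since \<open>0 powr p = 0\<close> for every p, the identity survives at t = 0 even when
  \<open>q - 2\<close> is negative. This realises the convention that the nonlinearity is zero where
  \<open>u\<close> is.\<close>

lemma abs_powr_mult_nonneg: "0 \<le> t \<Longrightarrow> \<bar>t\<bar> powr (q - 2) * t = t powr (q - 1)" for t q :: real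
  using powr_mult_base[of t "q - 2"] by (cases "t = 0") (simp_all add: mult.commute)

lemma abs_abs_powr_mult: "\<bar>\<bar>t\<bar> powr (q - 2) * t\<bar> = \<bar>t\<bar> powr (q - 1)" for t q :: real
  using abs_powr_mult_nonneg[of "\<bar>t\<bar>" q] by (simp add: abs_mult)

section \<open>Integral operators and almost everywhere changes of the coefficients\<close>

context fractional_space
begin

lemma finite_M: "finite_measure M"
proof
  have "emeasure lborel \<Omega> < \<infinity>"
    by (rule emeasure_bounded_finite[OF dom(2)])
  then show "emeasure M (space M) \<noteq> \<infinity>"
    by (simp add: space_restrict_space emeasure_restrict_space)
qed

sublocale M: finite_measure M
  by (rule finite_M)

lemma measurable_M_pair:
  assumes "H \<in> borel_measurable (lborel \<Otimes>\<^sub>M lborel)"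
  shows "H \<in> borel_measurable (M \<Otimes>\<^sub>M M)"
proof -
  have "(\<lambda>x. x) \<in> M \<rightarrow>\<^sub>M lborel"
    by (intro measurable_restrict_space1) simp
  then have "(\<lambda>z. (fst z, snd z)) \<in> M \<Otimes>\<^sub>M M \<rightarrow>\<^sub>M lborel \<Otimes>\<^sub>M lborel"
    by (intro measurable_Pair measurable_compose[OF measurable_fst]
          measurable_compose[OF measurable_snd])
  from measurable_compose[OF this assms] show ?thesis
    by simp
qed

lemma section_measurable:
  assumes "H \<in> borel_measurable (lborel \<Otimes>\<^sub>M lborel)"
  shows "(\<lambda>y. H (x, y)) \<in> borel_measurable M"
  using assms by (intro measurable_M measurable_compose_Pair1) auto

lemma kernel_integral_measurable:
  fixes H :: "(real^'n) \<times> (real^'n) \<Rightarrow> real"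
  assumes H: "H \<in> borel_measurable (lborel \<Otimes>\<^sub>M lborel)" and u: "u \<in> borel_measurable M"
  shows "(\<lambda>x. LINT y|M. H (x, y) * u y) \<in> borel_measurable M"
proof (rule M.borel_measurable_lebesgue_integral)
  have "(\<lambda>z. H z * u (snd z)) \<in> borel_measurable (M \<Otimes>\<^sub>M M)"
    by (intro borel_measurable_times measurable_M_pair H measurable_compose[OF measurable_snd u])
  then show "(\<lambda>(x, y). H (x, y) * u y) \<in> borel_measurable (M \<Otimes>\<^sub>M M)"
    by (simp add: case_prod_unfold)
qed

text \<open>\<open>H\<close> is measurable only on the product of the domain with itself. Its zero
  extension \<open>H0\<close> agrees with it there and is measurable on the whole product, which
  gives measurable sections; \<open>lborel_pair.AE_pair\<close> turns a null set of the product into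
  null sections for almost every x.\<close>

lemma kernel_integral_cong_AE:
  fixes H H' :: "(real^'n) \<times> (real^'n) \<Rightarrow> real"
  assumes H: "H \<in> borel_measurable (lborel_on (\<Omega> \<times> \<Omega>))"
    and H': "H' \<in> borel_measurable (lborel \<Otimes>\<^sub>M lborel)"
    and eq: "AE z in lborel_on (\<Omega> \<times> \<Omega>). H z = H' z"
    and g: "g \<in> borel_measurable M"
  shows "(\<lambda>x. LINT y|M. H (x, y) * g y) \<in> borel_measurable M"
    and "AE x in M. (LINT y|M. H (x, y) * g y) = (LINT y|M. H' (x, y) * g y)"
proof -
  define H0 where "H0 z = indicator (\<Omega> \<times> \<Omega>) z *\<^sub>R H z" for z
  have prod_borel: "\<Omega> \<times> \<Omega> \<in> sets borel"
    by (intro borel_open open_Times dom)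
  have "H0 \<in> borel_measurable (lborel :: ((real^'n) \<times> (real^'n)) measure)"
    unfolding H0_def using H prod_borel by (subst (asm) borel_measurable_restrict_space_iff) auto
  then have H0: "H0 \<in> borel_measurable (lborel \<Otimes>\<^sub>M lborel)"
    by (simp only: lborel_prod)
  have H_H0: "(LINT y|M. H (x, y) * g y) = (LINT y|M. H0 (x, y) * g y)" if "x \<in> \<Omega>" for x
    using that by (intro Bochner_Integration.integral_cong) (auto simp: H0_def space_restrict_space)
  show "(\<lambda>x. LINT y|M. H (x, y) * g y) \<in> borel_measurable M"
    using kernel_integral_measurable[OF H0 g]
    by (rule measurable_cong[THEN iffD1, rotated]) (simp add: H_H0 space_restrict_space)
  have "AE z in lborel \<Otimes>\<^sub>M lborel. z \<in> \<Omega> \<times> \<Omega> \<longrightarrow> H z = H' z"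
    using eq unfolding lborel_prod by (subst (asm) AE_restrict_space_iff) (use prod_borel in auto)
  from lborel_pair.AE_pair[OF this]
  have "AE x in lborel. x \<in> \<Omega> \<longrightarrow>
      (LINT y|M. H (x, y) * g y) = (LINT y|M. H' (x, y) * g y)"
  proof eventually_elim
    fix x assume ae: "AE y in lborel. (x, y) \<in> \<Omega> \<times> \<Omega> \<longrightarrow> H (x, y) = H' (x, y)"
    show "x \<in> \<Omega> \<longrightarrow> (LINT y|M. H (x, y) * g y) = (LINT y|M. H' (x, y) * g y)"
    proof
      assume x: "x \<in> \<Omega>"
      have "(LINT y|M. H0 (x, y) * g y) = (LINT y|M. H' (x, y) * g y)"
      proof (intro integral_cong_AE borel_measurable_times section_measurable H0 H' g)
        show "AE y in M. H0 (x, y) * g y = H' (x, y) * g y"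
          unfolding AE_M_iff using ae by eventually_elim (simp add: H0_def x)
      qed
      then show "(LINT y|M. H (x, y) * g y) = (LINT y|M. H' (x, y) * g y)"
        using H_H0[OF x] by simp
    qed
  qed
  then show "AE x in M. (LINT y|M. H (x, y) * g y) = (LINT y|M. H' (x, y) * g y)"
    unfolding AE_M_iff .
qed

text \<open>The coefficients enter only through integrals over the domain, so representatives may be
  exchanged. This reduces the problem to Borel coefficients that are bounded everywhere.\<close>

lemma weak_solution_cong_AE:
  assumes K: "K \<in> borel_measurable (lborel_on (\<Omega> \<times> \<Omega>))"
      "K' \<in> borel_measurable (lborel \<Otimes>\<^sub>M lborel)" "AE z in lborel_on (\<Omega> \<times> \<Omega>). K z = K' z"
    and Q: "Q \<in> borel_measurable (lborel_on (\<Omega> \<times> \<Omega>))"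
      "Q' \<in> borel_measurable (lborel \<Otimes>\<^sub>M lborel)" "AE z in lborel_on (\<Omega> \<times> \<Omega>). Q z = Q' z"
    and a: "a \<in> borel_measurable M" "a' \<in> borel_measurable lborel" "AE x in M. a x = a' x"
  shows "weak_solution s \<Omega> q lam a K Q f u \<longleftrightarrow> weak_solution s \<Omega> q lam a' K' Q' f u"
proof (cases "u \<in> X")
  case True
  note u = X_measurable_M[OF True]
  note uq = abs_powr_measurable[OF u]
  have "A_form s \<Omega> K a u \<phi> = A_form s \<Omega> K' a' u \<phi> \<and>
      (LINT x|M. N_op \<Omega> q Q u x * \<phi> x) = (LINT x|M. N_op \<Omega> q Q' u x * \<phi> x)"
    if "\<phi> \<in> X" for \<phi>
  proof -
    note \<phi> = X_measurable_M[OF that]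
    have "(LINT x|M. T_op \<Omega> K u x * \<phi> x) = (LINT x|M. T_op \<Omega> K' u x * \<phi> x)"
      unfolding T_op_def
      by (intro integral_cong_AE borel_measurable_times kernel_integral_cong_AE(1)[OF K u]
            kernel_integral_measurable[OF K(2) u] \<phi>)
         (use kernel_integral_cong_AE(2)[OF K u] in \<open>auto elim: eventually_mono\<close>)
    moreover have "(LINT x|M. a x * u x * \<phi> x) = (LINT x|M. a' x * u x * \<phi> x)"
      by (intro integral_cong_AE borel_measurable_times u \<phi> a(1) measurable_M[OF a(2)])
         (use a(3) in \<open>auto elim: eventually_mono\<close>)
    moreover have "(LINT x|M. N_op \<Omega> q Q u x * \<phi> x) = (LINT x|M. N_op \<Omega> q Q' u x * \<phi> x)"
      unfolding N_op_def B_op_def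
      by (intro integral_cong_AE borel_measurable_times kernel_integral_cong_AE(1)[OF Q uq]
            kernel_integral_measurable[OF Q(2) uq] u uq \<phi>)
         (use kernel_integral_cong_AE(2)[OF Q uq[where p = q]] in \<open>auto elim: eventually_mono\<close>)
    ultimately show ?thesis
      by (simp add: A_form_def)
  qed
  then show ?thesis
    unfolding weak_solution_def by auto
qed (simp add: weak_solution_def)

end

text \<open>Weak maximum principle: the negative part is an admissible nonnegative test function,
  and the energy of \<open>u\<close> against it is at most minus its own energy, which must then
  vanish.\<close>

lemma (in fractional_space) nonneg_of_energy_nonneg:
  assumes u: "u \<in> X"
    and pos: "\<And>\<phi>. \<phi> \<in> X \<Longrightarrow> AE x in lborel. 0 \<le> \<phi> x \<Longrightarrow> 0 \<le> \<E> u \<phi>"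
  shows "AE x in lborel. 0 \<le> u x"
proof -
  have "0 \<le> \<E> u (\<lambda>x. max (- u x) 0)"
    using u by (intro pos X0_neg_part) auto
  then have "\<E> (\<lambda>x. max (- u x) 0) (\<lambda>x. max (- u x) 0) \<le> 0"
    using energy_neg_part_le[OF s X0_Hs[OF u]] by linarith
  from energy_zero_imp_AE_zero[OF X0_neg_part[OF u] this] show ?thesis
    by eventually_elim (simp add: max_def split: if_splits)
qed

text \<open>Bounds and signs of the coefficients hold at every point, so \<open>T u x\<close> and
  \<open>B u x\<close> can be estimated and passed to the limit at each x without discarding null
  sets. \<open>A\<close>, \<open>k\<close> and \<open>m\<close> will be the essential
  suprema.\<close>

locale nonlocal_problem = fractional_space s \<Omega> C1 C2
  for s :: real and \<Omega> :: "(real^'n) set" and C1 C2 +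
  fixes q lam Cq A k m :: real
    and a :: "real^'n \<Rightarrow> real"
    and K Q :: "(real^'n) \<times> (real^'n) \<Rightarrow> real"
    and f :: "(real^'n \<Rightarrow> real) \<Rightarrow> real"
  assumes q: "1 < q"
    and sobq: "sobolev_const s \<Omega> q Cq"
    and a_measurable [measurable]: "a \<in> borel_measurable lborel"
    and K_measurable [measurable]: "K \<in> borel_measurable (lborel \<Otimes>\<^sub>M lborel)"
    and Q_measurable [measurable]: "Q \<in> borel_measurable (lborel \<Otimes>\<^sub>M lborel)"
    and a_bound: "\<And>x. \<bar>a x\<bar> \<le> A"
    and K_bound: "\<And>z. 0 \<le> K z" "\<And>z. K z \<le> k"
    and Q_bound: "\<And>z. 0 \<le> Q z" "\<And>z. Q z \<le> m"
    and f: "f \<in> X0_dual s \<Omega>"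
    and f_nonneg: "X0_dual_nonneg s \<Omega> f"
begin

abbreviation "T \<equiv> T_op \<Omega> K"
abbreviation "B \<equiv> B_op \<Omega> q Q"
abbreviation "N \<equiv> N_op \<Omega> q Q"

definition R :: "(real^'n \<Rightarrow> real) \<Rightarrow> (real^'n \<Rightarrow> real) \<Rightarrow> real" where
  "R w \<phi> = (LINT x|M. T w x * \<phi> x) + (LINT x|M. a x * w x * \<phi> x)
             + lam * (LINT x|M. N w x * \<phi> x) + f \<phi>"

lemma weak_solution_iff:
  "weak_solution s \<Omega> q lam a K Q f u \<longleftrightarrow> u \<in> X \<and> (\<forall>\<phi>\<in>X. \<E> u \<phi> = R u \<phi>)"
  unfolding weak_solution_def A_form_def R_def by (auto simp: algebra_simps)

lemma bounds_nonneg: "0 \<le> A" "0 \<le> k" "0 \<le> m"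
  using a_bound[of undefined] K_bound[of undefined] Q_bound[of undefined] by auto

lemma measure_M: "measure M (space M) = measure lborel \<Omega>"
  by (simp add: space_restrict_space measure_restrict_space)

lemmas [measurable] = measurable_M[OF a_measurable]

section \<open>Estimates for the lower-order terms\<close>

lemma X0_Lq:
  assumes "u \<in> X"
  shows "integrable M (\<lambda>x. \<bar>u x\<bar> powr q)"
    and "(LINT x|M. \<bar>u x\<bar> powr q) powr (1 / q) \<le> Cq * X0_norm s u"
  using sobq assms by (auto simp: sobolev_const_def Lp_def Lp_norm_def)

lemma Cq_pos: "0 < Cq" and C2_pos: "0 < C2"
  using sobq sob2 by (auto simp: sobolev_const_def)

lemma X0_L2_norm:
  assumes "u \<in> X"
  shows "sqrt (LINT x|M. (u x)\<^sup>2) \<le> C2 * X0_norm s u"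
  using X0_L2[OF assms] C2_pos X0_norm_nonneg[of u]
  by (intro real_le_lsqrt) (auto simp: power_mult_distrib X0_norm_sq)

text \<open>Cauchy-Schwarz against the constant 1 replaces the embedding constant \<open>C1\<close>,
  because the product of two such bounds yields the factor
  \<open>measure lborel \<Omega> * C2\<^sup>2\<close> that occurs in \<eta>.\<close>

lemma X0_L1_norm:
  assumes u: "u \<in> X"
  shows "(LINT x|M. \<bar>u x\<bar>) \<le> sqrt (measure lborel \<Omega>) * (C2 * X0_norm s u)"
proof -
  have "(LINT x|M. \<bar>1\<bar> * \<bar>u x\<bar>) \<le> sqrt (LINT x|M. 1\<^sup>2) * sqrt (LINT x|M. (u x)\<^sup>2)"
    using X_measurable_M[OF u] X0_L2[OF u] by (intro Cauchy_Schwarz_integral) auto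
  also have "\<dots> \<le> sqrt (measure lborel \<Omega>) * (C2 * X0_norm s u)"
    using X0_L2_norm[OF u] measure_M by (intro mult_mono) auto
  finally show ?thesis
    by simp
qed

lemma T_measurable [measurable]: "u \<in> borel_measurable M \<Longrightarrow> T u \<in> borel_measurable M"
  unfolding T_op_def by (rule kernel_integral_measurable[OF K_measurable])

lemma B_measurable [measurable]: "u \<in> borel_measurable M \<Longrightarrow> B u \<in> borel_measurable M"
  unfolding B_op_def by (intro kernel_integral_measurable[OF Q_measurable] abs_powr_measurable)

lemma N_measurable [measurable]: "u \<in> borel_measurable M \<Longrightarrow> N u \<in> borel_measurable M"
  unfolding N_op_def by (intro borel_measurable_times abs_powr_measurable B_measurable)

lemma T_bound:
  assumes "u \<in> X"
  shows "\<bar>T u x\<bar> \<le> k * (LINT y|M. \<bar>u y\<bar>)"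
proof -
  have "\<bar>T u x\<bar> \<le> (LINT y|M. \<bar>K (x, y) * u y\<bar>)"
    unfolding T_op_def by (rule integral_abs_bound)
  also have "\<dots> \<le> (LINT y|M. k * \<bar>u y\<bar>)"
    using X0_L1(1)[OF assms] K_bound bounds_nonneg
    by (intro integral_mono') (auto simp: abs_mult intro: mult_right_mono mult_nonneg_nonneg)
  finally show ?thesis
    by simp
qed

lemma B_bound:
  assumes "u \<in> X"
  shows "0 \<le> B u x" "B u x \<le> m * (LINT y|M. \<bar>u y\<bar> powr q)"
proof -
  show "0 \<le> B u x"
    unfolding B_op_def using Q_bound by (intro Bochner_Integration.integral_nonneg) auto
  have "B u x \<le> (LINT y|M. m * \<bar>u y\<bar> powr q)"
    unfolding B_op_def using X0_Lq(1)[OF assms] Q_bound bounds_nonneg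
    by (intro integral_mono') (auto intro: mult_right_mono)
  then show "B u x \<le> m * (LINT y|M. \<bar>u y\<bar> powr q)"
    by simp
qed

lemma N_bound:
  assumes "u \<in> X"
  shows "\<bar>N u x\<bar> \<le> m * (LINT y|M. \<bar>u y\<bar> powr q) * \<bar>u x\<bar> powr (q - 1)"
  unfolding N_op_def abs_mult abs_abs_powr_mult[unfolded abs_mult]
  using mult_left_mono[OF B_bound(2)[OF assms, of x], of "\<bar>u x\<bar> powr (q - 1)"] B_bound(1)[OF assms, of x]
  by (simp add: mult.commute)

context
  fixes w \<phi> assumes w: "w \<in> X" and \<phi>: "\<phi> \<in> X"
begin

private lemma wM [measurable]: "w \<in> borel_measurable M" "\<phi> \<in> borel_measurable M"
  using w \<phi> X_measurable_M by auto

lemma T_integral: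
  shows "integrable M (\<lambda>x. T w x * \<phi> x)"
    and "\<bar>LINT x|M. T w x * \<phi> x\<bar> \<le> k * measure lborel \<Omega> * C2\<^sup>2 * X0_norm s w * X0_norm s \<phi>"
proof -
  define I where "I = k * (LINT y|M. \<bar>w y\<bar>)"
  have I: "0 \<le> I"
    unfolding I_def using bounds_nonneg by (auto intro!: mult_nonneg_nonneg Bochner_Integration.integral_nonneg)
  have le: "\<bar>T w x * \<phi> x\<bar> \<le> I * \<bar>\<phi> x\<bar>" for x
    unfolding abs_mult I_def using T_bound[OF w] by (intro mult_right_mono) auto
  have int: "integrable M (\<lambda>x. I * \<bar>\<phi> x\<bar>)"
    using X0_L1(1)[OF \<phi>] by simp
  show "integrable M (\<lambda>x. T w x * \<phi> x)"
    by (rule Bochner_Integration.integrable_bound[OF int])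
       (use le I in \<open>auto simp: abs_mult\<close>)
  have "\<bar>LINT x|M. T w x * \<phi> x\<bar> \<le> (LINT x|M. I * \<bar>\<phi> x\<bar>)"
    using le int I by (intro order_trans[OF integral_abs_bound] integral_mono') auto
  also have "\<dots> = k * ((LINT y|M. \<bar>w y\<bar>) * (LINT x|M. \<bar>\<phi> x\<bar>))"
    by (simp add: I_def)
  also have "\<dots> \<le> k * ((sqrt (measure lborel \<Omega>) * (C2 * X0_norm s w))
                      * (sqrt (measure lborel \<Omega>) * (C2 * X0_norm s \<phi>)))"
    using bounds_nonneg C2_pos X0_norm_nonneg[of w]
    by (intro mult_left_mono mult_mono X0_L1_norm w \<phi> Bochner_Integration.integral_nonneg
          mult_nonneg_nonneg) auto
  also have "\<dots> = k * (sqrt (measure lborel \<Omega>))\<^sup>2 * C2\<^sup>2 * X0_norm s w * X0_norm s \<phi>"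
    by (simp only: power2_eq_square mult_ac)
  finally show "\<bar>LINT x|M. T w x * \<phi> x\<bar> \<le> k * measure lborel \<Omega> * C2\<^sup>2 * X0_norm s w * X0_norm s \<phi>"
    by simp
qed

lemma a_integral:
  shows "integrable M (\<lambda>x. a x * w x * \<phi> x)"
    and "\<bar>LINT x|M. a x * w x * \<phi> x\<bar> \<le> A * C2\<^sup>2 * X0_norm s w * X0_norm s \<phi>"
proof -
  have cs: "integrable M (\<lambda>x. \<bar>w x\<bar> * \<bar>\<phi> x\<bar>)"
    "(LINT x|M. \<bar>w x\<bar> * \<bar>\<phi> x\<bar>) \<le> sqrt (LINT x|M. (w x)\<^sup>2) * sqrt (LINT x|M. (\<phi> x)\<^sup>2)"
    using X0_L2(1)[OF w] X0_L2(1)[OF \<phi>] by (auto intro!: Cauchy_Schwarz_integral)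
  have le: "\<bar>a x * w x * \<phi> x\<bar> \<le> A * (\<bar>w x\<bar> * \<bar>\<phi> x\<bar>)" for x
    using mult_right_mono[OF a_bound[of x], of "\<bar>w x\<bar> * \<bar>\<phi> x\<bar>"] by (simp add: abs_mult mult.assoc)
  have int: "integrable M (\<lambda>x. A * (\<bar>w x\<bar> * \<bar>\<phi> x\<bar>))"
    using cs(1) by simp
  show "integrable M (\<lambda>x. a x * w x * \<phi> x)"
    by (rule Bochner_Integration.integrable_bound[OF int])
       (use le bounds_nonneg in \<open>auto simp: abs_mult\<close>)
  have "\<bar>LINT x|M. a x * w x * \<phi> x\<bar> \<le> (LINT x|M. A * (\<bar>w x\<bar> * \<bar>\<phi> x\<bar>))"
    using le int bounds_nonneg by (intro order_trans[OF integral_abs_bound] integral_mono') auto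
  also have "\<dots> = A * (LINT x|M. \<bar>w x\<bar> * \<bar>\<phi> x\<bar>)"
    by simp
  also have "\<dots> \<le> A * ((C2 * X0_norm s w) * (C2 * X0_norm s \<phi>))"
    using bounds_nonneg C2_pos X0_norm_nonneg[of w]
    by (intro mult_left_mono order_trans[OF cs(2)] mult_mono X0_L2_norm w \<phi>) auto
  finally show "\<bar>LINT x|M. a x * w x * \<phi> x\<bar> \<le> A * C2\<^sup>2 * X0_norm s w * X0_norm s \<phi>"
    by (simp only: power2_eq_square mult_ac)
qed

lemma N_integral:
  shows "integrable M (\<lambda>x. N w x * \<phi> x)"
    and "\<bar>LINT x|M. N w x * \<phi> x\<bar> \<le>
           m * Cq powr (2 * q) * X0_norm s w powr (2 * q - 1) * X0_norm s \<phi>"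
proof -
  define I where "I = (LINT y|M. \<bar>w y\<bar> powr q)"
  have I: "0 \<le> I"
    unfolding I_def by (auto intro!: Bochner_Integration.integral_nonneg)
  have ho: "integrable M (\<lambda>x. \<bar>w x\<bar> powr (q - 1) * \<bar>\<phi> x\<bar>)"
    "(LINT x|M. \<bar>w x\<bar> powr (q - 1) * \<bar>\<phi> x\<bar>) \<le>
       I powr ((q - 1) / q) * (LINT x|M. \<bar>\<phi> x\<bar> powr q) powr (1 / q)"
    using Holder_abs_powr[OF q wM X0_Lq(1)[OF w] X0_Lq(1)[OF \<phi>]] by (auto simp: I_def)
  have le: "\<bar>N w x * \<phi> x\<bar> \<le> m * I * (\<bar>w x\<bar> powr (q - 1) * \<bar>\<phi> x\<bar>)" for x
    using mult_right_mono[OF N_bound[OF w, of x], of "\<bar>\<phi> x\<bar>"] by (simp add: abs_mult I_def mult.assoc)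
  have int: "integrable M (\<lambda>x. m * I * (\<bar>w x\<bar> powr (q - 1) * \<bar>\<phi> x\<bar>))"
    using ho(1) by simp
  have mI: "0 \<le> m * I"
    using bounds_nonneg I by simp
  show "integrable M (\<lambda>x. N w x * \<phi> x)"
    by (rule Bochner_Integration.integrable_bound[OF int])
       (use le in \<open>auto intro!: order_trans[OF _ abs_ge_self]\<close>)
  have Iq: "I powr (1 / q) \<le> Cq * X0_norm s w"
    unfolding I_def by (rule X0_Lq(2)[OF w])
  have c: "0 \<le> Cq * X0_norm s w"
    using Cq_pos X0_norm_nonneg[of w] by simp
  have "\<bar>LINT x|M. N w x * \<phi> x\<bar> \<le> (LINT x|M. m * I * (\<bar>w x\<bar> powr (q - 1) * \<bar>\<phi> x\<bar>))"
    using le int mI by (intro order_trans[OF integral_abs_bound] integral_mono') auto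
  also have "\<dots> = m * I * (LINT x|M. \<bar>w x\<bar> powr (q - 1) * \<bar>\<phi> x\<bar>)"
    by simp
  also have "\<dots> \<le> m * I * (I powr ((q - 1) / q) * (LINT x|M. \<bar>\<phi> x\<bar> powr q) powr (1 / q))"
    by (intro mult_left_mono ho(2) mI)
  \<comment> \<open>The factor \<open>I\<close> from the nonlocal term and the Hoelder factor
    combine, as \<open>1 + (q - 1) / q = (2 * q - 1) / q\<close>, into a power of the Lq norm of
    \<open>w\<close>.\<close>
  also have "\<dots> = m * ((I powr (1 / q)) powr (2 * q - 1) * (LINT x|M. \<bar>\<phi> x\<bar> powr q) powr (1 / q))"
  proof -
    have "I * I powr ((q - 1) / q) = I powr (1 + (q - 1) / q)"
      using powr_mult_base[OF I] by simp
    also have "1 + (q - 1) / q = 1 / q * (2 * q - 1)"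
      using q by (simp add: field_simps)
    finally show ?thesis
      by (simp add: powr_powr)
  qed
  also have "\<dots> \<le> m * ((Cq * X0_norm s w) powr (2 * q - 1) * (Cq * X0_norm s \<phi>))"
    using bounds_nonneg q by (intro mult_left_mono mult_mono powr_mono2 Iq X0_Lq(2) \<phi>) auto
  also have "\<dots> = m * (Cq powr (2 * q - 1) * Cq) * X0_norm s w powr (2 * q - 1) * X0_norm s \<phi>"
    using Cq_pos X0_norm_nonneg[of w] by (simp add: powr_mult)
  also have "Cq powr (2 * q - 1) * Cq = Cq powr (2 * q)"
    using Cq_pos powr_mult_base[of Cq "2 * q - 1"] by (simp add: mult.commute)
  finally show "\<bar>LINT x|M. N w x * \<phi> x\<bar> \<le>
           m * Cq powr (2 * q) * X0_norm s w powr (2 * q - 1) * X0_norm s \<phi>" .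
qed

end

end

section \<open>The functional \<open>R\<close>: boundedness, monotonicity and limits of dominated
  sequences\<close>

context nonlocal_problem
begin

lemma f_scale: "u \<in> X \<Longrightarrow> f (\<lambda>x. c * u x) = c * f u"
  using f by (simp add: X0_dual_def)

lemma f_bounded: "\<exists>C. \<forall>u\<in>X. \<bar>f u\<bar> \<le> C * X0_norm s u"
  using f by (simp add: X0_dual_def)

lemma f_comb:
  assumes "u \<in> X" "v \<in> X"
  shows "f (\<lambda>x. u x + c * v x) = f u + c * f v"
proof -
  have add: "\<forall>u\<in>X. \<forall>v\<in>X. f (\<lambda>x. u x + v x) = f u + f v"
    using f by (simp add: X0_dual_def)
  have "(\<lambda>x. c * v x) \<in> X"
    using X0_comb[OF X0_zero assms(2)] by simp
  from add[rule_format, OF assms(1) this] show ?thesis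
    by (simp add: f_scale assms(2))
qed

lemma K_section_integrable:
  assumes "u \<in> X"
  shows "integrable M (\<lambda>y. K (x, y) * u y)"
proof (rule Bochner_Integration.integrable_bound)
  show "integrable M (\<lambda>y. k * u y)"
    using X0_L1(1)[OF assms] by simp
  show "(\<lambda>y. K (x, y) * u y) \<in> borel_measurable M"
    by (intro borel_measurable_times section_measurable[OF K_measurable] X_measurable_M assms)
  show "AE y in M. norm (K (x, y) * u y) \<le> norm (k * u y)"
    using K_bound bounds_nonneg by (intro AE_I2) (auto simp: abs_mult intro: mult_right_mono)
qed

lemma Q_section_integrable:
  assumes "u \<in> X"
  shows "integrable M (\<lambda>y. Q (x, y) * \<bar>u y\<bar> powr q)"
proof (rule Bochner_Integration.integrable_bound)
  show "integrable M (\<lambda>y. m * \<bar>u y\<bar> powr q)"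
    using X0_Lq(1)[OF assms] by simp
  show "(\<lambda>y. Q (x, y) * \<bar>u y\<bar> powr q) \<in> borel_measurable M"
    by (intro borel_measurable_times section_measurable[OF Q_measurable] abs_powr_measurable
          X_measurable_M assms)
  show "AE y in M. norm (Q (x, y) * \<bar>u y\<bar> powr q) \<le> norm (m * \<bar>u y\<bar> powr q)"
    using Q_bound bounds_nonneg by (intro AE_I2) (auto simp: abs_mult intro: mult_right_mono)
qed

lemma N_eq: "0 \<le> u x \<Longrightarrow> N u x = u x powr (q - 1) * B u x"
  unfolding N_op_def by (simp only: abs_powr_mult_nonneg)

lemma B_mono:
  assumes "w \<in> X" "w' \<in> X" "AE x in M. 0 \<le> w x \<and> w x \<le> w' x"
  shows "B w x \<le> B w' x"
  unfolding B_op_def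
proof (intro integral_mono_AE Q_section_integrable assms(1,2))
  show "AE y in M. Q (x, y) * \<bar>w y\<bar> powr q \<le> Q (x, y) * \<bar>w' y\<bar> powr q"
    using assms(3) by eventually_elim (use q Q_bound in \<open>auto intro!: mult_left_mono powr_mono2\<close>)
qed

lemma X0_norm_zero: "X0_norm s (\<lambda>x::real^'n. 0) = 0"
  by (simp add: X0_norm_def energy_def gagliardo_kernel_def case_prod_unfold)

lemma f_unit_ball_bdd: "bdd_above ((\<lambda>u. \<bar>f u\<bar>) ` {u \<in> X. X0_norm s u \<le> 1})"
proof -
  obtain C where C: "\<And>u. u \<in> X \<Longrightarrow> \<bar>f u\<bar> \<le> C * X0_norm s u"
    using f_bounded by blast
  show ?thesis
  proof (rule bdd_aboveI2)
    fix u assume "u \<in> {u \<in> X. X0_norm s u \<le> 1}"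
    then have u: "u \<in> X" "X0_norm s u \<le> 1"
      by auto
    have "\<bar>f u\<bar> \<le> C * X0_norm s u"
      by (rule C[OF u(1)])
    also have "\<dots> \<le> \<bar>C\<bar> * 1"
      using u(2) X0_norm_nonneg[of u] by (intro mult_mono) auto
    finally show "\<bar>f u\<bar> \<le> \<bar>C\<bar>"
      by simp
  qed
qed

lemma f_le_dual_norm:
  assumes \<phi>: "\<phi> \<in> X"
  shows "\<bar>f \<phi>\<bar> \<le> X0_dual_norm s \<Omega> f * X0_norm s \<phi>"
proof -
  obtain C where C: "\<And>u. u \<in> X \<Longrightarrow> \<bar>f u\<bar> \<le> C * X0_norm s u"
    using f_bounded by blast
  show ?thesis
  proof (cases "X0_norm s \<phi> = 0")
    \<comment> \<open>A function of norm zero cannot be normalised; boundedness of \<open>f\<close>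
      makes \<open>f \<phi>\<close> vanish.\<close>
    case True
    then show ?thesis
      using C[OF \<phi>] by simp
  next
    case False
    define c where "c = inverse (X0_norm s \<phi>)"
    have c: "0 < c"
      using False X0_norm_nonneg[of \<phi>] by (simp add: c_def)
    define \<psi> where "\<psi> = (\<lambda>x. c * \<phi> x)"
    have \<psi>: "\<psi> \<in> X"
      unfolding \<psi>_def using X0_comb[OF X0_zero \<phi>, of c] by simp
    \<comment> \<open>Scaling is read as \<open>0 + c * \<phi>\<close>; linearity at
      \<open>0 + (-1) * 0\<close> shows that the terms containing the zero function vanish.\<close>
    have "\<E> \<psi> \<psi> = c\<^sup>2 * \<E> \<phi> \<phi>"
      unfolding \<psi>_def using E_comb_self[OF X0_zero \<phi>, of c] E_comb[OF X0_zero X0_zero X0_zero, of "-1"]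
        E_comb[OF X0_zero X0_zero \<phi>, of "-1"] by simp
    then have norm1: "X0_norm s \<psi> = 1"
      unfolding X0_norm_def using c False
      by (simp add: real_sqrt_mult c_def X0_norm_def[symmetric])
    have "\<bar>f \<psi>\<bar> \<le> X0_dual_norm s \<Omega> f"
      unfolding X0_dual_norm_def by (rule cSUP_upper[OF _ f_unit_ball_bdd]) (simp add: \<psi> norm1)
    moreover have "f \<psi> = c * f \<phi>"
      unfolding \<psi>_def by (rule f_scale[OF \<phi>])
    ultimately show ?thesis
      using c False X0_norm_nonneg[of \<phi>] by (simp add: abs_mult c_def field_simps)
  qed
qed

lemma X0_dual_norm_nonneg: "0 \<le> X0_dual_norm s \<Omega> f"
proof -
  have "\<bar>f (\<lambda>x. 0)\<bar> \<le> X0_dual_norm s \<Omega> f"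
    unfolding X0_dual_norm_def by (rule cSUP_upper[OF _ f_unit_ball_bdd]) (simp add: X0_zero X0_norm_zero)
  then show ?thesis
    by linarith
qed

text \<open>A bound for the dual norm of \<open>R w\<close> when \<open>w\<close> has norm t. The
  smallness assumption on a radius r, multiplied by r, says that \<open>R_const r\<close> is at most
  r.\<close>

definition R_const :: "real \<Rightarrow> real" where
  "R_const t = C2\<^sup>2 * (A + measure lborel \<Omega> * k) * t
     + \<bar>lam\<bar> * m * Cq powr (2 * q) * t powr (2 * q - 1) + X0_dual_norm s \<Omega> f"

lemma R_bound:
  assumes "w \<in> X" "\<phi> \<in> X"
  shows "\<bar>R w \<phi>\<bar> \<le> R_const (X0_norm s w) * X0_norm s \<phi>"
proof -
  have "\<bar>lam * (LINT x|M. N w x * \<phi> x)\<bar> \<le>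
      \<bar>lam\<bar> * (m * Cq powr (2 * q) * X0_norm s w powr (2 * q - 1) * X0_norm s \<phi>)"
    unfolding abs_mult by (intro mult_left_mono N_integral assms) auto
  then show ?thesis
    unfolding R_def R_const_def
    using T_integral(2)[OF assms] a_integral(2)[OF assms] f_le_dual_norm[OF assms(2)]
    by (simp add: algebra_simps)
qed

lemma R_bdd_functional:
  assumes w: "w \<in> X"
  shows "bdd_functional (R w)"
  unfolding bdd_functional_def
proof (intro conjI ballI allI)
  fix u v c assume uv: "u \<in> X" "v \<in> X"
  show "R w (\<lambda>x. u x + c * v x) = R w u + c * R w v"
    unfolding R_def using T_integral(1)[OF w uv(1)] T_integral(1)[OF w uv(2)]
      a_integral(1)[OF w uv(1)] a_integral(1)[OF w uv(2)]
      N_integral(1)[OF w uv(1)] N_integral(1)[OF w uv(2)]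
    by (simp add: f_comb[OF uv] ring_distribs mult.left_commute[of _ c])
next
  show "\<exists>C. \<forall>u\<in>X. \<bar>R w u\<bar> \<le> C * sqrt (\<E> u u)"
    using R_bound[OF w] unfolding X0_norm_def by blast
qed

text \<open>Testing the Riesz representative of \<open>R w\<close> with itself bounds the square of
  its norm by \<open>R_const (X0_norm s w)\<close> times the norm, and one factor cancels unless the
  norm is zero.\<close>

lemma solution_operator:
  assumes w: "w \<in> X"
  shows "\<exists>u. u \<in> X \<and> (\<forall>\<phi>\<in>X. \<E> u \<phi> = R w \<phi>) \<and> X0_norm s u \<le> R_const (X0_norm s w)"
proof -
  obtain u where u: "u \<in> X" and eq: "\<And>\<phi>. \<phi> \<in> X \<Longrightarrow> \<E> u \<phi> = R w \<phi>"
    using riesz_representation[OF R_bdd_functional[OF w]] by blast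
  have const: "0 \<le> R_const (X0_norm s w)"
  proof -
    show ?thesis
      unfolding R_const_def using bounds_nonneg X0_norm_nonneg[of w] X0_dual_norm_nonneg by simp
  qed
  have "X0_norm s u * X0_norm s u \<le> R_const (X0_norm s w) * X0_norm s u"
    using X0_norm_sq[of u] eq[OF u] R_bound[OF w u] by (simp add: power2_eq_square)
  then have "X0_norm s u \<le> R_const (X0_norm s w)"
    using const X0_norm_nonneg[of u] by (cases "X0_norm s u = 0") auto
  with u eq show ?thesis
    by auto
qed

text \<open>The kernels, \<open>a\<close>, \<open>lam\<close> and the test function are nonnegative
  and the powers q and \<open>q - 1\<close> are increasing on nonnegative numbers, so each integral
  term increases with \<open>w\<close>; the term \<open>f \<phi>\<close> is common to both
  sides.\<close>

lemma R_mono: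
  assumes lam: "0 \<le> lam" and a_nonneg: "\<And>x. 0 \<le> a x"
    and w: "w \<in> X" and w': "w' \<in> X" and \<phi>: "\<phi> \<in> X"
    and pos: "AE x in lborel. 0 \<le> w x" "AE x in lborel. 0 \<le> \<phi> x"
    and le: "AE x in lborel. w x \<le> w' x"
  shows "R w \<phi> \<le> R w' \<phi>"
proof -
  have AEM: "AE x in M. 0 \<le> w x" "AE x in M. 0 \<le> \<phi> x" "AE x in M. w x \<le> w' x"
    using pos le AE_M by blast+
  have T_le: "T w x \<le> T w' x" for x
    unfolding T_op_def
    using AEM(3) K_bound by (intro integral_mono_AE K_section_integrable w w') (auto elim: eventually_mono intro: mult_left_mono)
  have B_le: "B w x \<le> B w' x" for x
    using AEM(1,3) by (intro B_mono w w') auto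
  have "(LINT x|M. T w x * \<phi> x) \<le> (LINT x|M. T w' x * \<phi> x)"
    using AEM(2) T_le
    by (intro integral_mono_AE T_integral w w' \<phi>) (auto elim: eventually_mono intro: mult_right_mono)
  moreover have "(LINT x|M. a x * w x * \<phi> x) \<le> (LINT x|M. a x * w' x * \<phi> x)"
  proof (intro integral_mono_AE a_integral w w' \<phi>)
    show "AE x in M. a x * w x * \<phi> x \<le> a x * w' x * \<phi> x"
      using AEM(2,3) by eventually_elim (auto intro!: mult_right_mono mult_left_mono a_nonneg)
  qed
  moreover have "(LINT x|M. N w x * \<phi> x) \<le> (LINT x|M. N w' x * \<phi> x)"
  proof (intro integral_mono_AE N_integral w w' \<phi>)
    show "AE x in M. N w x * \<phi> x \<le> N w' x * \<phi> x"
      using AEM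
    proof eventually_elim
      fix x assume x: "0 \<le> w x" "0 \<le> \<phi> x" "w x \<le> w' x"
      then have "N w x = w x powr (q - 1) * B w x" "N w' x = w' x powr (q - 1) * B w' x"
        by (simp_all add: N_eq)
      then show "N w x * \<phi> x \<le> N w' x * \<phi> x"
        using x q B_le[of x] B_bound(1)[OF w, of x]
        by (auto intro!: mult_right_mono mult_mono powr_mono2)
    qed
  qed
  ultimately show ?thesis
    unfolding R_def using mult_left_mono[OF _ lam] by (simp add: add_mono)
qed

text \<open>The limit \<open>u\<close> serves as majorant, so dominated convergence applies twice:
  first to the inner integrals of \<open>T\<close> and \<open>B\<close>, at every x, then to the
  outer integrals against \<open>\<phi>\<close>.\<close>

lemma R_tendsto:
  assumes w: "\<And>k::nat. w k \<in> X" and u: "u \<in> X" and \<phi>: "\<phi> \<in> X"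
    and between: "\<And>k. AE x in lborel. 0 \<le> w k x \<and> w k x \<le> u x"
    and lim: "AE x in lborel. (\<lambda>k. w k x) \<longlonglongrightarrow> u x"
  shows "(\<lambda>k. R (w k) \<phi>) \<longlonglongrightarrow> R u \<phi>"
proof -
  have bet: "AE x in M. 0 \<le> w k x \<and> w k x \<le> u x" for k
    using between[of k] by (rule AE_M)
  have limM: "AE x in M. (\<lambda>k. w k x) \<longlonglongrightarrow> u x"
    using lim by (rule AE_M)
  have u0: "AE x in M. 0 \<le> u x"
    using bet[of 0] by eventually_elim simp
  have betA: "AE x in M. \<forall>k. 0 \<le> w k x \<and> w k x \<le> u x"
    unfolding AE_all_countable using bet by blast
  note meas = X_measurable_M[OF u] X_measurable_M[OF \<phi>] X_measurable_M[OF w]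
  have T_lim: "(\<lambda>k. T (w k) x) \<longlonglongrightarrow> T u x" for x
    unfolding T_op_def
  proof (rule integral_dominated_convergence)
    show "integrable M (\<lambda>y. k * \<bar>u y\<bar>)"
      using X0_L1(1)[OF u] by simp
    show "AE y in M. (\<lambda>k. K (x, y) * w k y) \<longlonglongrightarrow> K (x, y) * u y"
      using limM by eventually_elim (rule tendsto_mult_left)
    show "AE y in M. norm (K (x, y) * w j y) \<le> k * \<bar>u y\<bar>" for j
      using bet[of j] by eventually_elim (use K_bound bounds_nonneg in \<open>auto simp: abs_mult intro!: mult_mono\<close>)
  qed (intro borel_measurable_times section_measurable[OF K_measurable] meas)+
  have B_lim: "(\<lambda>k. B (w k) x) \<longlonglongrightarrow> B u x" for x
    unfolding B_op_def
  proof (rule integral_dominated_convergence)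
    show "integrable M (\<lambda>y. m * \<bar>u y\<bar> powr q)"
      using X0_Lq(1)[OF u] by simp
    show "AE y in M. (\<lambda>k. Q (x, y) * \<bar>w k y\<bar> powr q) \<longlonglongrightarrow> Q (x, y) * \<bar>u y\<bar> powr q"
      using limM
    proof eventually_elim
      fix y assume "(\<lambda>k. w k y) \<longlonglongrightarrow> u y"
      then show "(\<lambda>k. Q (x, y) * \<bar>w k y\<bar> powr q) \<longlonglongrightarrow> Q (x, y) * \<bar>u y\<bar> powr q"
        \<comment> \<open>The limit \<open>u y\<close> may be zero; the power is continuous there
          because the exponent is positive.\<close>
        using q by (intro tendsto_mult_left tendsto_powr' tendsto_rabs tendsto_const) auto
    qed
    show "AE y in M. norm (Q (x, y) * \<bar>w j y\<bar> powr q) \<le> m * \<bar>u y\<bar> powr q" for j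
      using bet[of j]
      by eventually_elim (use Q_bound q bounds_nonneg in \<open>auto simp: abs_mult intro!: mult_mono powr_mono2\<close>)
  qed (intro borel_measurable_times section_measurable[OF Q_measurable] abs_powr_measurable meas)+
  have "(\<lambda>k. LINT x|M. T (w k) x * \<phi> x) \<longlonglongrightarrow> (LINT x|M. T u x * \<phi> x)"
  proof (rule integral_dominated_convergence)
    show "integrable M (\<lambda>x. k * (LINT y|M. \<bar>u y\<bar>) * \<bar>\<phi> x\<bar>)"
      using X0_L1(1)[OF \<phi>] by simp
    show "AE x in M. (\<lambda>k. T (w k) x * \<phi> x) \<longlonglongrightarrow> T u x * \<phi> x"
      by (intro AE_I2 tendsto_mult_right T_lim)
    have "\<bar>T (w j) x\<bar> \<le> k * (LINT y|M. \<bar>u y\<bar>)" for j x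
    proof (rule order_trans[OF T_bound[OF w]])
      have "(LINT y|M. \<bar>w j y\<bar>) \<le> (LINT y|M. \<bar>u y\<bar>)"
        using X0_L1(1)[OF w] X0_L1(1)[OF u] bet[of j]
        by (intro integral_mono_AE) (auto elim: eventually_mono)
      then show "k * (LINT y|M. \<bar>w j y\<bar>) \<le> k * (LINT y|M. \<bar>u y\<bar>)"
        using bounds_nonneg by (intro mult_left_mono) auto
    qed
    then show "AE x in M. norm (T (w j) x * \<phi> x) \<le> k * (LINT y|M. \<bar>u y\<bar>) * \<bar>\<phi> x\<bar>" for j
      by (intro AE_I2) (auto simp: abs_mult intro!: mult_right_mono)
  qed (intro borel_measurable_times T_measurable meas)+
  moreover have "(\<lambda>k. LINT x|M. a x * w k x * \<phi> x) \<longlonglongrightarrow> (LINT x|M. a x * u x * \<phi> x)"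
  proof (rule integral_dominated_convergence)
    show "integrable M (\<lambda>x. \<bar>a x * u x * \<phi> x\<bar>)"
      using a_integral(1)[OF u \<phi>] by simp
    show "AE x in M. (\<lambda>k. a x * w k x * \<phi> x) \<longlonglongrightarrow> a x * u x * \<phi> x"
      using limM by eventually_elim (intro tendsto_mult_right tendsto_mult_left)
    show "AE x in M. norm (a x * w j x * \<phi> x) \<le> \<bar>a x * u x * \<phi> x\<bar>" for j
      using bet[of j] by eventually_elim (auto simp: abs_mult intro!: mult_mono)
  qed (intro borel_measurable_times measurable_M[OF a_measurable] meas)+
  moreover have "(\<lambda>k. LINT x|M. N (w k) x * \<phi> x) \<longlonglongrightarrow> (LINT x|M. N u x * \<phi> x)"
  proof (rule integral_dominated_convergence)
    show "integrable M (\<lambda>x. \<bar>N u x * \<phi> x\<bar>)"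
      using N_integral(1)[OF u \<phi>] by simp
    show "AE x in M. (\<lambda>k. N (w k) x * \<phi> x) \<longlonglongrightarrow> N u x * \<phi> x"
      using limM betA u0
    proof eventually_elim
      fix x assume x: "(\<lambda>k. w k x) \<longlonglongrightarrow> u x" "\<forall>k. 0 \<le> w k x \<and> w k x \<le> u x" "0 \<le> u x"
      have "(\<lambda>k. w k x powr (q - 1) * B (w k) x) \<longlonglongrightarrow> u x powr (q - 1) * B u x"
        using x q by (intro tendsto_mult B_lim tendsto_powr' tendsto_const) auto
      then show "(\<lambda>k. N (w k) x * \<phi> x) \<longlonglongrightarrow> N u x * \<phi> x"
        using x by (intro tendsto_mult_right) (simp add: N_eq)
    qed
    show "AE x in M. norm (N (w j) x * \<phi> x) \<le> \<bar>N u x * \<phi> x\<bar>" for j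
      using bet[of j]
    proof eventually_elim
      fix x assume x: "0 \<le> w j x \<and> w j x \<le> u x"
      have "B (w j) x \<le> B u x"
        by (rule B_mono[OF w u bet])
      then show "norm (N (w j) x * \<phi> x) \<le> \<bar>N u x * \<phi> x\<bar>"
        using x q B_bound(1)[OF w, of j x] B_bound(1)[OF u, of x]
        by (auto simp: N_eq abs_mult intro!: mult_right_mono mult_mono powr_mono2)
    qed
  qed (intro borel_measurable_times N_measurable meas)+
  ultimately show ?thesis
    unfolding R_def by (intro tendsto_add tendsto_mult_left tendsto_const)
qed

section \<open>Existence by monotone iteration\<close>

lemma nonneg_solution_exists:
  assumes lam: "0 \<le> lam" and a_nonneg: "\<And>x. 0 \<le> a x"
    and r0: "0 < r"
    and r: "\<bar>lam\<bar> * m * Cq powr (2 * q) * r powr (2 * q - 2) + X0_dual_norm s \<Omega> f / r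
              \<le> 1 - C2\<^sup>2 * (A + measure lborel \<Omega> * k)"
  shows "\<exists>u. weak_solution s \<Omega> q lam a K Q f u \<and> (AE x in lborel. 0 \<le> u x) \<and> X0_norm s u \<le> r"
proof -
  \<comment> \<open>Monotonicity in t reduces this to t = r, where it is the smallness assumption
    multiplied by r. The ball of radius r is therefore invariant under the iteration.\<close>
  have R_const_le: "R_const t \<le> r" if "0 \<le> t" "t \<le> r" for t
  proof -
    have "R_const t \<le> C2\<^sup>2 * (A + measure lborel \<Omega> * k) * r
        + \<bar>lam\<bar> * m * Cq powr (2 * q) * r powr (2 * q - 1) + X0_dual_norm s \<Omega> f"
      unfolding R_const_def using that bounds_nonneg q
      by (intro add_mono mult_left_mono powr_mono2 order_refl) auto
    also have "r powr (2 * q - 1) = r powr (2 * q - 2) * r"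
      using r0 powr_mult_base[of r "2 * q - 2"] by (simp add: mult.commute)
    also have "C2\<^sup>2 * (A + measure lborel \<Omega> * k) * r
        + \<bar>lam\<bar> * m * Cq powr (2 * q) * (r powr (2 * q - 2) * r) + X0_dual_norm s \<Omega> f
      = r * (C2\<^sup>2 * (A + measure lborel \<Omega> * k)
        + (\<bar>lam\<bar> * m * Cq powr (2 * q) * r powr (2 * q - 2) + X0_dual_norm s \<Omega> f / r))"
      using r0 by (simp add: field_simps)
    also have "\<dots> \<le> r * 1"
      using r r0 by (intro mult_left_mono) auto
    finally show ?thesis
      by simp
  qed
  \<comment> \<open>Riesz representatives are determined only up to null sets, so the operator to be
    iterated is obtained by choice.\<close>
  from bchoice[OF ballI[OF solution_operator]] obtain S where "\<forall>w\<in>X. S w \<in> X \<and>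
      (\<forall>\<phi>\<in>X. \<E> (S w) \<phi> = R w \<phi>) \<and> X0_norm s (S w) \<le> R_const (X0_norm s w)" ..
  then have S: "\<And>w. w \<in> X \<Longrightarrow> S w \<in> X" "\<And>w \<phi>. w \<in> X \<Longrightarrow> \<phi> \<in> X \<Longrightarrow> \<E> (S w) \<phi> = R w \<phi>"
    "\<And>w. w \<in> X \<Longrightarrow> X0_norm s (S w) \<le> R_const (X0_norm s w)"
    by auto
  define U where "U n = (S ^^ n) (\<lambda>x. 0)" for n
  have U0: "U 0 = (\<lambda>x. 0)" and U_Suc: "U (Suc n) = S (U n)" for n
    by (simp_all add: U_def)
  have U: "U n \<in> X" for n
    by (induction n) (simp_all add: U0 U_Suc X0_zero S)
  have E_U: "\<E> (U (Suc n)) \<phi> = R (U n) \<phi>" if "\<phi> \<in> X" for n \<phi>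
    unfolding U_Suc using S(2)[OF U that] .
  have U_norm: "X0_norm s (U n) \<le> r" for n
  proof (induction n)
    case 0
    then show ?case
      using r0 by (simp add: U0 X0_norm_zero)
  next
    case (Suc n)
    then show ?case
      using S(3)[OF U[of n]] R_const_le[OF X0_norm_nonneg Suc] unfolding U_Suc by linarith
  qed
  have R_zero: "R (\<lambda>x. 0) \<phi> = f \<phi>" for \<phi>
    by (simp add: R_def T_op_def N_op_def)
  \<comment> \<open>Induction with the weak maximum principle: the first iterate sees only
    \<open>f\<close>, and the energy of a later increment is a difference of values of
    \<open>R\<close>, nonnegative by \<open>R_mono\<close>. Nonnegativity is carried along because
    \<open>R_mono\<close> asks it of the smaller function.\<close>
  have mono: "AE x in lborel. 0 \<le> U n x \<and> U n x \<le> U (Suc n) x" for n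
  proof (induction n)
    case 0
    have "AE x in lborel. 0 \<le> U (Suc 0) x"
      using f_nonneg unfolding X0_dual_nonneg_def
      by (intro nonneg_of_energy_nonneg U) (simp add: E_U U0 R_zero)
    then show ?case
      by (simp add: U0)
  next
    case (Suc n)
    then have n: "AE x in lborel. 0 \<le> U n x" "AE x in lborel. U n x \<le> U (Suc n) x"
      by (auto elim: eventually_mono)
    have "AE x in lborel. 0 \<le> U (Suc (Suc n)) x - U (Suc n) x"
    proof (rule nonneg_of_energy_nonneg)
      fix \<phi> assume \<phi>: "\<phi> \<in> X" "AE x in lborel. 0 \<le> \<phi> x"
      show "0 \<le> \<E> (\<lambda>x. U (Suc (Suc n)) x - U (Suc n) x) \<phi>"
        using R_mono[OF lam a_nonneg U U \<phi>(1) n(1) \<phi>(2) n(2)] E_diff[OF U U \<phi>(1)] E_U[OF \<phi>(1)] by simp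
    qed (rule X0_diff[OF U U])
    with Suc show ?case
      by eventually_elim linarith
  qed
  then have all_mono: "AE x in lborel. \<forall>n. 0 \<le> U n x \<and> U n x \<le> U (Suc n) x"
    unfolding AE_all_countable by blast
  have U_nonneg: "AE x in lborel. 0 \<le> U n x" for n
    using mono[of n] by eventually_elim simp
  have U_le: "AE x in lborel. U i x \<le> U j x" if "i \<le> j" for i j
    using all_mono by eventually_elim (use that in \<open>auto intro: lift_Suc_mono_le\<close>)
  \<comment> \<open>For positive i the two sides are \<open>R (U i')\<close> and
    \<open>R (U j')\<close> on the nonnegative test function \<open>U i\<close>, with both indices
    lowered by one. For i = 0 both sides are zero.\<close>
  have E_U_le: "\<E> (U i) (U i) \<le> \<E> (U j) (U i)" if "i \<le> j" for i j
  proof (cases i)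
    case 0
    then show ?thesis
      using E_sym[OF U U] by (simp add: U0 energy_def gagliardo_kernel_def case_prod_unfold)
  next
    case (Suc i')
    then obtain j' where j: "j = Suc j'" "i' \<le> j'"
      using \<open>i \<le> j\<close> Suc by (cases j) auto
    show ?thesis
      unfolding Suc j(1) E_U[OF U]
      by (rule R_mono[OF lam a_nonneg U U U U_nonneg U_nonneg U_le[OF j(2)]])
  qed
  have E_diff_le: "\<E> (\<lambda>x. U j x - U i x) (\<lambda>x. U j x - U i x) \<le> \<E> (U j) (U j) - \<E> (U i) (U i)"
    if "i \<le> j" for i j
    using E_diff_self[OF U U, of j i] E_U_le[OF that] by linarith
  define e where "e n = \<E> (U n) (U n)" for n
  have "incseq e"
  proof (rule incseq_SucI)
    show "e n \<le> e (Suc n)" for n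
      using E_diff_le[of n "Suc n"] E_nonneg[OF X0_diff[OF U U], of "Suc n" n] unfolding e_def by linarith
  qed
  moreover have "e n \<le> r\<^sup>2" for n
    unfolding e_def X0_norm_sq[symmetric] using U_norm X0_norm_nonneg by (intro power_mono)
  ultimately have "convergent e"
    using incseq_convergent unfolding convergent_def by blast
  then have cauchy_e: "Cauchy e"
    by (rule convergent_Cauchy)
  have "\<exists>M. \<forall>i\<ge>M. \<forall>j\<ge>M. \<E> (\<lambda>x. U i x - U j x) (\<lambda>x. U i x - U j x) < d" if "0 < d" for d
  proof -
    obtain M where M: "\<And>i j. i \<ge> M \<Longrightarrow> j \<ge> M \<Longrightarrow> dist (e i) (e j) < d"
      using metric_CauchyD[OF cauchy_e \<open>0 < d\<close>] by blast
    have "\<E> (\<lambda>x. U i x - U j x) (\<lambda>x. U i x - U j x) < d" if ij: "i \<ge> M" "j \<ge> M" for i j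
    proof (cases "j \<le> i")
      case True
      then show ?thesis
        using E_diff_le[OF True] M[OF ij] unfolding e_def dist_real_def by linarith
    next
      case False
      have "\<E> (\<lambda>x. U i x - U j x) (\<lambda>x. U i x - U j x) = \<E> (\<lambda>x. U j x - U i x) (\<lambda>x. U j x - U i x)"
        using E_diff_self[OF U U, of j i] E_diff_self[OF U U, of i j] E_sym[OF U U, of i j] by linarith
      then show ?thesis
        using False E_diff_le[of i j] M[OF ij] unfolding e_def dist_real_def by linarith
    qed
    then show ?thesis
      by blast
  qed
  from X0_complete[OF U this] obtain u \<sigma> where u: "u \<in> X" and \<sigma>: "strict_mono \<sigma>"
    and lim: "AE x in lborel. (\<lambda>k. U (\<sigma> k) x) \<longlonglongrightarrow> u x"
    and Elim: "(\<lambda>n. \<E> (\<lambda>x. U n x - u x) (\<lambda>x. U n x - u x)) \<longlonglongrightarrow> 0"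
    by blast
  \<comment> \<open>An increasing sequence stays below its limit, so \<open>u\<close> is the
    majorant that \<open>R_tendsto\<close> requires.\<close>
  have between: "AE x in lborel. 0 \<le> U (\<sigma> k) x \<and> U (\<sigma> k) x \<le> u x" for k
    using all_mono lim
  proof eventually_elim
    fix x assume x: "\<forall>n. 0 \<le> U n x \<and> U n x \<le> U (Suc n) x" "(\<lambda>k. U (\<sigma> k) x) \<longlonglongrightarrow> u x"
    have "incseq (\<lambda>n. U n x)"
      using x(1) by (intro incseq_SucI) auto
    then have "incseq (\<lambda>k. U (\<sigma> k) x)"
      using \<sigma> by (auto simp: incseq_def strict_mono_less_eq)
    then show "0 \<le> U (\<sigma> k) x \<and> U (\<sigma> k) x \<le> u x"
      using incseq_le[OF _ x(2)] x(1) by blast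
  qed
  \<comment> \<open>The equation links index n + 1 to index n. The left side is followed along
    \<open>Suc (\<sigma> k)\<close>, using energy convergence of the full sequence, and the right
    side along \<open>\<sigma> k\<close>, using pointwise convergence.\<close>
  have "\<E> u \<phi> = R u \<phi>" if \<phi>: "\<phi> \<in> X" for \<phi>
  proof (rule LIMSEQ_unique)
    have "(\<lambda>n. \<E> (U n) \<phi>) \<longlonglongrightarrow> \<E> u \<phi>"
      by (rule tendsto_E_left[OF U u \<phi> Elim])
    moreover have "strict_mono (\<lambda>k. Suc (\<sigma> k))"
      using \<sigma> by (simp add: strict_mono_def)
    ultimately have "(\<lambda>k. \<E> (U (Suc (\<sigma> k))) \<phi>) \<longlonglongrightarrow> \<E> u \<phi>"
      using LIMSEQ_subseq_LIMSEQ by (fastforce simp: o_def)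
    then show "(\<lambda>k. R (U (\<sigma> k)) \<phi>) \<longlonglongrightarrow> \<E> u \<phi>"
      by (simp add: E_U[OF \<phi>])
    show "(\<lambda>k. R (U (\<sigma> k)) \<phi>) \<longlonglongrightarrow> R u \<phi>"
      by (rule R_tendsto[OF U u \<phi> between lim])
  qed
  moreover have "AE x in lborel. 0 \<le> u x"
    using between[of 0] by eventually_elim linarith
  moreover have "\<E> u u \<le> r\<^sup>2"
    using X0_lower_semicontinuous(2)[OF U X0_measurable[OF u] lim] \<open>\<And>n. e n \<le> r\<^sup>2\<close> unfolding e_def by blast
  then have "X0_norm s u \<le> r"
    unfolding X0_norm_def using r0 by (intro real_le_lsqrt) auto
  ultimately show ?thesis
    using u weak_solution_iff by blast
qed

section \<open>Sign and nontriviality of weak solutions\<close>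

lemma weak_solution_nonneg:
  assumes lam: "lam < 0" and eta: "C2\<^sup>2 * (A + measure lborel \<Omega> * k) < 1"
    and sol: "weak_solution s \<Omega> q lam a K Q f u"
  shows "AE x in lborel. 0 \<le> u x"
proof -
  define w where "w = (\<lambda>x. max (- u x) 0)"
  have u: "u \<in> X" and eq: "\<And>\<phi>. \<phi> \<in> X \<Longrightarrow> \<E> u \<phi> = R u \<phi>"
    using sol weak_solution_iff by auto
  have w: "w \<in> X"
    unfolding w_def by (rule X0_neg_part[OF u])
  have w0: "0 \<le> w x" for x
    by (simp add: w_def)
  \<comment> \<open>The kernel is nonnegative and \<open>u\<close> lies above \<open>- w\<close>;
    this bounds the term below through \<open>w\<close> alone.\<close>
  have "- T w x \<le> T u x" for x
  proof -
    have "- T w x = (LINT y|M. - (K (x, y) * w y))"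
      by (simp add: T_op_def)
    also have "\<dots> \<le> T u x"
      unfolding T_op_def
    proof (rule integral_mono)
      show "- (K (x, y) * w y) \<le> K (x, y) * u y" for y
        using mult_left_mono[of "- w y" "u y" "K (x, y)"] K_bound(1) by (simp add: w_def)
    qed (simp_all add: K_section_integrable u w)
    finally show ?thesis .
  qed
  then have "(LINT x|M. - (T w x * w x)) \<le> (LINT x|M. T u x * w x)"
    using mult_right_mono[OF _ w0] T_integral(1)[OF u w] T_integral(1)[OF w w]
    by (intro integral_mono) fastforce+
  then have T_ge: "- (k * measure lborel \<Omega> * C2\<^sup>2 * \<E> w w) \<le> (LINT x|M. T u x * w x)"
    using T_integral(2)[OF w w] X0_norm_sq[of w] by (simp add: power2_eq_square mult.assoc)
  \<comment> \<open>Where \<open>w\<close> is nonzero, \<open>u = - w\<close>. Only the size of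
    \<open>a\<close> matters in the resulting bound, not its sign.\<close>
  have "a x * u x * w x = - (a x * w x * w x)" for x
    by (simp add: w_def max_def)
  then have a_ge: "- (A * C2\<^sup>2 * \<E> w w) \<le> (LINT x|M. a x * u x * w x)"
    using a_integral(2)[OF w w] X0_norm_sq[of w] by (simp add: power2_eq_square mult.assoc)
  have "N u x * w x \<le> 0" for x
  proof -
    have "u x * w x \<le> 0"
      by (simp add: w_def max_def mult_nonneg_nonpos mult_nonpos_nonneg)
    then have "(\<bar>u x\<bar> powr (q - 2) * B u x) * (u x * w x) \<le> 0"
      using B_bound(1)[OF u, of x] by (intro mult_nonneg_nonpos[OF mult_nonneg_nonneg]) auto
    then show ?thesis
      by (simp add: N_op_def mult_ac)
  qed
  then have "(LINT x|M. N u x * w x) \<le> 0"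
    using Bochner_Integration.integral_nonneg[of M "\<lambda>x. - (N u x * w x)"] by simp
  then have N_ge: "0 \<le> lam * (LINT x|M. N u x * w x)"
    using lam by (simp add: mult_nonpos_nonpos)
  have "0 \<le> f w"
    using f_nonneg w w0 unfolding X0_dual_nonneg_def by auto
  then have "- (C2\<^sup>2 * (A + measure lborel \<Omega> * k) * \<E> w w) \<le> R u w"
    unfolding R_def using T_ge a_ge N_ge by (simp add: algebra_simps)
  moreover have "R u w \<le> - \<E> w w"
    using energy_neg_part_le[OF s X0_Hs[OF u]] eq[OF w] by (simp add: w_def)
  ultimately have "(1 - C2\<^sup>2 * (A + measure lborel \<Omega> * k)) * \<E> w w \<le> 0"
    by (simp add: algebra_simps)
  then have "\<E> w w \<le> 0"
    using eta by (simp add: mult_le_0_iff)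
  from energy_zero_imp_AE_zero[OF w this] show ?thesis
    by eventually_elim (simp add: w_def max_def split: if_splits)
qed

text \<open>For a function that is zero almost everywhere, the energy and every term of
  \<open>R\<close> except \<open>f\<close> vanish, so the equation would force \<open>f\<close> to
  be zero on \<open>X\<close>.\<close>

lemma weak_solution_nontrivial:
  assumes sol: "weak_solution s \<Omega> q lam a K Q f u" and f0: "X0_dual_nonzero s \<Omega> f"
  shows "\<not> (AE x in lborel. u x = 0)"
proof
  assume zero: "AE x in lborel. u x = 0"
  then have zM: "AE x in M. u x = 0"
    by (rule AE_M)
  have u: "u \<in> X" and eq: "\<And>\<phi>. \<phi> \<in> X \<Longrightarrow> \<E> u \<phi> = R u \<phi>"
    using sol weak_solution_iff by auto
  have "T u x = 0" for x
    unfolding T_op_def using zM by (intro integral_eq_zero_AE) (auto elim: eventually_mono)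
  moreover have "(LINT x|M. a x * u x * \<phi> x) = 0" "(LINT x|M. N u x * \<phi> x) = 0" for \<phi>
    using zM by (auto intro!: integral_eq_zero_AE elim: eventually_mono simp: N_op_def)
  ultimately have "R u \<phi> = f \<phi>" for \<phi>
    by (simp add: R_def)
  moreover have "\<E> u \<phi> = 0" if "\<phi> \<in> X" for \<phi>
  proof -
    have "\<E> u \<phi> = \<E> (\<lambda>x. 0) \<phi>"
      by (intro energy_cong_AE X0_measurable[OF u] X0_measurable[OF that] zero) simp
    then show ?thesis
      by (simp add: energy_def gagliardo_kernel_def case_prod_unfold)
  qed
  ultimately show False
    using f0 eq unfolding X0_dual_nonzero_def by metis
qed

end

section \<open>Reduction to bounded Borel coefficients\<close>

text \<open>Positive measure makes the essential supremum of the zero function, and hence that of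
  the absolute value, nonnegative. Being also finite, it is recovered exactly by
  \<open>real_of_ereal\<close>.\<close>

lemma Linf_AE_bound:
  assumes g: "g \<in> Linf M" and pos: "emeasure M (space M) \<noteq> 0"
  shows "AE x in M. \<bar>g x\<bar> \<le> Linf_norm M g" and "0 \<le> Linf_norm M g"
proof -
  define e where "e = esssup M (\<lambda>x. ereal \<bar>g x\<bar>)"
  have [measurable]: "g \<in> borel_measurable M"
    using g by (simp add: Linf_def)
  have "esssup M (\<lambda>x. 0 :: ereal) \<le> e"
    unfolding e_def by (rule esssup_mono) auto
  then have e0: "0 \<le> e"
    using pos by (simp add: esssup_const)
  have "e < \<infinity>"
    using g by (simp add: Linf_def e_def)
  then have e: "e = ereal (Linf_norm M g)"
    using e0 unfolding Linf_norm_def e_def[symmetric] by (cases e) auto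
  show "0 \<le> Linf_norm M g"
    using e0 unfolding e by simp
  show "AE x in M. \<bar>g x\<bar> \<le> Linf_norm M g"
    using esssup_AE[where M = M and f = "\<lambda>x. ereal \<bar>g x\<bar>"] unfolding e_def[symmetric] e by simp
qed

text \<open>Extension by zero off \<open>S\<close>, then truncation to the interval from
  \<open>lo\<close> to \<open>hi\<close>, which alters values only on a null subset of
  \<open>S\<close>.\<close>

lemma bounded_borel_representative:
  fixes g :: "'a::euclidean_space \<Rightarrow> real"
  assumes S: "S \<in> sets borel" and g: "g \<in> borel_measurable (lborel_on S)"
    and lo: "lo \<le> 0" and hi: "0 \<le> hi" and bnd: "AE x in lborel_on S. lo \<le> g x \<and> g x \<le> hi"
  obtains h where "h \<in> borel_measurable lborel" "\<And>x. lo \<le> h x" "\<And>x. h x \<le> hi"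
    "AE x in lborel_on S. g x = h x"
proof
  define g0 where "g0 x = indicator S x *\<^sub>R g x" for x
  have g0: "g0 \<in> borel_measurable lborel"
    unfolding g0_def using g S by (subst (asm) borel_measurable_restrict_space_iff) auto
  then show "(\<lambda>x. max lo (min hi (g0 x))) \<in> borel_measurable lborel"
    by (intro borel_measurable_max borel_measurable_min) auto
  show "lo \<le> max lo (min hi (g0 x))" "max lo (min hi (g0 x)) \<le> hi" for x
    using lo hi by auto
  have ae: "AE x in lborel. x \<in> S \<longrightarrow> lo \<le> g x \<and> g x \<le> hi"
    using bnd S by (subst (asm) AE_restrict_space_iff) auto
  have "AE x in lborel. x \<in> S \<longrightarrow> g x = max lo (min hi (g0 x))"
    using ae by eventually_elim (auto simp: g0_def)
  then show "AE x in lborel_on S. g x = max lo (min hi (g0 x))"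
    using S by (subst AE_restrict_space_iff) auto
qed

lemma emeasure_lborel_open_pos:
  fixes S :: "'a::euclidean_space set"
  assumes "open S" "S \<noteq> {}"
  shows "0 < emeasure lborel S"
proof -
  obtain x e where e: "0 < e" and sub: "ball x e \<subseteq> S"
    using assms open_contains_ball by blast
  have "0 < unit_ball_vol (real DIM('a)) * e ^ DIM('a)"
    using e by simp
  then have "0 < emeasure lborel (ball x e)"
    using e by (simp add: emeasure_ball)
  also have "\<dots> \<le> emeasure lborel S"
    using sub assms by (intro emeasure_mono) auto
  finally show ?thesis .
qed

theorem proposition4p4:
  fixes \<Omega> :: "(real^'n) set"
    and s q lam r \<eta> \<gamma> :: real
    and C_S :: "real \<Rightarrow> real"
    and a :: "real^'n \<Rightarrow> real"
    and K Q :: "(real^'n) \<times> (real^'n) \<Rightarrow> real"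
    and f :: "(real^'n \<Rightarrow> real) \<Rightarrow> real"
  assumes dim: "2 \<le> CARD('n)"
    and dom: "bounded_lipschitz_domain \<Omega>"
    and s: "0 < s" "s < 1"
    and q: "1 < q" "q < crit_exp TYPE('n) s"
    and C_S: "\<And>p. 1 \<le> p \<Longrightarrow> p \<le> crit_exp TYPE('n) s \<Longrightarrow> sobolev_const s \<Omega> p (C_S p)"
    and a: "a \<in> Linf (lborel_on \<Omega>)"
    and K: "K \<in> Linf (lborel_on (\<Omega> \<times> \<Omega>))"
    and Q: "Q \<in> Linf (lborel_on (\<Omega> \<times> \<Omega>))"
    and f: "f \<in> X0_dual s \<Omega>"
    and eta: "\<eta> = (C_S 2)\<^sup>2 * (Linf_norm (lborel_on \<Omega>) a
                    + measure lborel \<Omega> * Linf_norm (lborel_on (\<Omega> \<times> \<Omega>)) K)"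
    and gamma: "\<gamma> = \<bar>lam\<bar> * Linf_norm (lborel_on (\<Omega> \<times> \<Omega>)) Q * C_S q powr (2 * q)"
    and eta_less: "\<eta> < 1"
    and r: "0 < r" "\<gamma> * r powr (2 * q - 2) + X0_dual_norm s \<Omega> f / r \<le> 1 - \<eta>"
    and K_nonneg: "AE z in lborel_on (\<Omega> \<times> \<Omega>). 0 \<le> K z"
    and Q_nonneg: "AE z in lborel_on (\<Omega> \<times> \<Omega>). 0 \<le> Q z"
    and f_nonneg: "X0_dual_nonneg s \<Omega> f"
  shows "(0 \<le> lam \<and> (AE x in lborel_on \<Omega>. 0 \<le> a x) \<longrightarrow>
            (\<exists>u. weak_solution s \<Omega> q lam a K Q f u \<and> (AE x in lborel. 0 \<le> u x) \<and> X0_norm s u \<le> r \<and>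
                 (X0_dual_nonzero s \<Omega> f \<longrightarrow> \<not> (AE x in lborel. u x = 0))))
       \<and> (lam < 0 \<longrightarrow>
            (\<forall>u. weak_solution s \<Omega> q lam a K Q f u \<longrightarrow>
                 (AE x in lborel. 0 \<le> u x) \<and>
                 (X0_dual_nonzero s \<Omega> f \<longrightarrow> \<not> (AE x in lborel. u x = 0))))"
proof -
  define A where "A = Linf_norm (lborel_on \<Omega>) a"
  define k where "k = Linf_norm (lborel_on (\<Omega> \<times> \<Omega>)) K"
  define m where "m = Linf_norm (lborel_on (\<Omega> \<times> \<Omega>)) Q"
  have \<Omega>: "open \<Omega>" "bounded \<Omega>" "\<Omega> \<noteq> {}"
    using dom by (auto simp: bounded_lipschitz_domain_def)
  have borel: "\<Omega> \<in> sets borel" "\<Omega> \<times> \<Omega> \<in> sets borel"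
    using \<Omega> by (auto intro!: borel_open open_Times)
  have pos: "emeasure (lborel_on \<Omega>) (space (lborel_on \<Omega>)) \<noteq> 0"
    "emeasure (lborel_on (\<Omega> \<times> \<Omega>)) (space (lborel_on (\<Omega> \<times> \<Omega>))) \<noteq> 0"
    using \<Omega> borel emeasure_lborel_open_pos[of \<Omega>] emeasure_lborel_open_pos[of "\<Omega> \<times> \<Omega>"]
    by (simp_all add: space_restrict_space emeasure_restrict_space open_Times)
  note a_norm = Linf_AE_bound[OF a pos(1), folded A_def]
  note K_norm = Linf_AE_bound[OF K pos(2), folded k_def]
  note Q_norm = Linf_AE_bound[OF Q pos(2), folded m_def]
  \<comment> \<open>The denominator of the critical exponent is positive since \<open>2 * s\<close>
    is below 2; the exponent is then at least 2, which admits the exponents 1 and 2 in the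
    embeddings.\<close>
  have "0 < real CARD('n) - 2 * s"
    using dim s by linarith
  then have crit: "2 \<le> crit_exp TYPE('n) s"
    using s by (simp add: crit_exp_def le_divide_eq)
  interpret fractional_space s \<Omega> "C_S 1" "C_S 2"
    using s \<Omega> C_S crit by unfold_locales auto
  have meas: "a \<in> borel_measurable (lborel_on \<Omega>)" "K \<in> borel_measurable (lborel_on (\<Omega> \<times> \<Omega>))"
    "Q \<in> borel_measurable (lborel_on (\<Omega> \<times> \<Omega>))"
    using a K Q by (auto simp: Linf_def)
  have "AE z in lborel_on (\<Omega> \<times> \<Omega>). 0 \<le> K z \<and> K z \<le> k"
    using K_nonneg K_norm(1) by eventually_elim auto
  then obtain K' where K': "K' \<in> borel_measurable lborel" "\<And>z. 0 \<le> K' z" "\<And>z. K' z \<le> k"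
    "AE z in lborel_on (\<Omega> \<times> \<Omega>). K z = K' z"
    using bounded_borel_representative[OF borel(2) meas(2) order_refl K_norm(2)] by blast
  have "AE z in lborel_on (\<Omega> \<times> \<Omega>). 0 \<le> Q z \<and> Q z \<le> m"
    using Q_nonneg Q_norm(1) by eventually_elim auto
  then obtain Q' where Q': "Q' \<in> borel_measurable lborel" "\<And>z. 0 \<le> Q' z" "\<And>z. Q' z \<le> m"
    "AE z in lborel_on (\<Omega> \<times> \<Omega>). Q z = Q' z"
    using bounded_borel_representative[OF borel(2) meas(3) order_refl Q_norm(2)] by blast
  have KQ: "K' \<in> borel_measurable (lborel \<Otimes>\<^sub>M lborel)" "Q' \<in> borel_measurable (lborel \<Otimes>\<^sub>M lborel)"
    using K'(1) Q'(1) by (simp_all only: lborel_prod)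
  \<comment> \<open>The representative of \<open>a\<close> stays open because the two cases truncate
    differently: to the interval from 0 to \<open>A\<close> for nonnegative \<open>a\<close>, and
    from \<open>- A\<close> to \<open>A\<close> for negative \<open>lam\<close>.\<close>
  have problem: "nonlocal_problem s \<Omega> (C_S 1) (C_S 2) q (C_S q) A k m a' K' Q' f"
    if "a' \<in> borel_measurable lborel" "\<And>x. \<bar>a' x\<bar> \<le> A" for a'
    using that K'(2,3) Q'(2,3) KQ q C_S f f_nonneg by unfold_locales auto
  have sol_iff: "weak_solution s \<Omega> q lam a K Q f u \<longleftrightarrow> weak_solution s \<Omega> q lam a' K' Q' f u"
    if "a' \<in> borel_measurable lborel" "AE x in lborel_on \<Omega>. a x = a' x" for a' u
    using weak_solution_cong_AE[OF meas(2) KQ(1) K'(4) meas(3) KQ(2) Q'(4) meas(1) that] .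
  show ?thesis
  proof (intro conjI impI allI; (elim conjE)?)
    assume lam: "0 \<le> lam" and a_nonneg: "AE x in lborel_on \<Omega>. 0 \<le> a x"
    have "AE x in lborel_on \<Omega>. 0 \<le> a x \<and> a x \<le> A"
      using a_nonneg a_norm(1) by eventually_elim auto
    then obtain a' where a': "a' \<in> borel_measurable lborel" "\<And>x. 0 \<le> a' x" "\<And>x. a' x \<le> A"
      "AE x in lborel_on \<Omega>. a x = a' x"
      using bounded_borel_representative[OF borel(1) meas(1) order_refl a_norm(2)] by blast
    interpret P: nonlocal_problem s \<Omega> "C_S 1" "C_S 2" q lam "C_S q" A k m a' K' Q' f
      by (rule problem) (use a' in auto)
    obtain u where u: "weak_solution s \<Omega> q lam a' K' Q' f u" "AE x in lborel. 0 \<le> u x" "X0_norm s u \<le> r"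
      using P.nonneg_solution_exists[OF lam a'(2) r(1)] r(2)
      unfolding eta gamma A_def k_def m_def by blast
    then show "\<exists>u. weak_solution s \<Omega> q lam a K Q f u \<and> (AE x in lborel. 0 \<le> u x) \<and> X0_norm s u \<le> r \<and>
                 (X0_dual_nonzero s \<Omega> f \<longrightarrow> \<not> (AE x in lborel. u x = 0))"
      using P.weak_solution_nontrivial[OF u(1)] sol_iff[OF a'(1,4)] by blast
  next
    fix u assume lam: "lam < 0" and sol: "weak_solution s \<Omega> q lam a K Q f u"
    have "AE x in lborel_on \<Omega>. - A \<le> a x \<and> a x \<le> A"
      using a_norm(1) by eventually_elim auto
    then obtain a' where a': "a' \<in> borel_measurable lborel" "\<And>x. - A \<le> a' x" "\<And>x. a' x \<le> A"
      "AE x in lborel_on \<Omega>. a x = a' x"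
      using bounded_borel_representative[OF borel(1) meas(1) _ a_norm(2), of "- A"] a_norm(2) by auto
    interpret P: nonlocal_problem s \<Omega> "C_S 1" "C_S 2" q lam "C_S q" A k m a' K' Q' f
      by (rule problem) (use a' in \<open>auto simp: abs_le_iff minus_le_iff\<close>)
    have sol': "weak_solution s \<Omega> q lam a' K' Q' f u"
      using sol sol_iff[OF a'(1,4)] by blast
    show "AE x in lborel. 0 \<le> u x"
      using P.weak_solution_nonneg[OF lam _ sol'] eta_less unfolding eta A_def k_def by blast
    show "\<not> (AE x in lborel. u x = 0)" if "X0_dual_nonzero s \<Omega> f"
      using P.weak_solution_nontrivial[OF sol' that] .
  qed
qed

end
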